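(* Let $E=\mathrm{ind}_m E_m$ be an LF-space with stepwise Schauder basis $(e_j)_{j\in\mathbb{N}}$ and associated backward shift $B$. If $B$ is mixing, then $B$ is sequentially hypercyclic.
   Context: $\mathbb{N}=\{1,2,\dots\}$, and $\mathbb{K}\in\{\mathbb{R},\mathbb{C}\}$ is the scalar field. LF-space: an inductive spectrum of Fréchet spaces $(E_m)_{m\in\mathbb{N}}$ is an increasing sequence of Fréchet spaces such that each inclusion $E_m\subset E_{m+1}$ is continuous. Its inductive limit (LF-space) $E=\mathrm{ind}_m E_m$ is the union $\bigcup_m E_m$ with the finest locally convex topology making every inclusion $E_m\subset E$ continuous; this topology is assumed to be Hausdorff. Stepwise Schauder basis: a sequence $(e_j)_{j\in\mathbb{N}}$ in $E_1$ which is a Schauder basis of $E_m$ for every $m\in\mathbb{N}$. Associated backward shift: if the linear map on $\mathrm{span}\{e_j: j\in\mathbb{N}\}$ given by $Be_1:=0$, $Be_j:=e_{j-1}$ for $j\ge 2$, extends to a continuous linear map $B:E\to E$, then $B$ is called the backward shift associated with $(e_j)_j$. Saying that $E$ has associated backward shift $B$ means that this continuous extension exists. A continuous linear operator $T$ on $E$ is (topologically) mixing if for all non-empty open $U,V\subseteq E$ the set $\{n\in\mathbb{N}: T^n(U)\cap V\neq\emptyset\}$ is cofinite in $\mathbb{N}$. $T$ is sequentially hypercyclic if there is $x\in E$ whose orbit $\{x,Tx,T^2x,\dots\}$ is sequentially dense in $E$, i.e. every element of $E$ is the limit of a sequence of elements of the orbit. *)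

theory Defs
  imports "HOL-Analysis.Analysis"
begin

text \<open>
  The scalar field is a type in the intersection of the classes \<^class>\<open>real_normed_field\<close> and
  \<^class>\<open>euclidean_space\<close>. Both \<^typ>\<open>real\<close> and \<^typ>\<open>complex\<close> are instances, and up to isometric
  isomorphism there are no others: a finite-dimensional commutative field extension of the reals is
  the reals or the complex numbers, and the multiplicative norm extending the absolute value is
  unique.

  The type \<open>'a\<close> is the ambient vector space; subspaces carrying their own topology are represented
  by an abstract topology on \<open>'a\<close> whose \<^const>\<open>topspace\<close> is the subspace. Sequences are indexed
  from \<open>0\<close>, so an object written with index \<open>j = 1, 2, \<dots>\<close> on paper has index \<open>j - 1\<close> here.
\<close>

locale rc_vector_space = vector_space scale
  for scale :: "'k::{real_normed_field,euclidean_space} \<Rightarrow> 'a::ab_group_add \<Rightarrow> 'a"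
begin

definition convex_set :: "'a set \<Rightarrow> bool" where
  "convex_set S \<longleftrightarrow>
     (\<forall>x\<in>S. \<forall>y\<in>S. \<forall>u\<ge>0. \<forall>v\<ge>0. u + v = 1 \<longrightarrow> scale (of_real u) x + scale (of_real v) y \<in> S)"

text \<open>A locally convex topology need not be Hausdorff here.\<close>

definition locally_convex_topology :: "'a set \<Rightarrow> 'a topology \<Rightarrow> bool" where
  "locally_convex_topology V X \<longleftrightarrow>
     subspace V \<and> topspace X = V \<and>
     continuous_map (prod_topology X X) X (\<lambda>(x, y). x + y) \<and>
     continuous_map (prod_topology euclidean X) X (\<lambda>(c, x). scale c x) \<and>
     (\<forall>U. openin X U \<and> 0 \<in> U \<longrightarrow> (\<exists>C. openin X C \<and> 0 \<in> C \<and> C \<subseteq> U \<and> convex_set C))"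

definition frechet_space :: "'a set \<Rightarrow> 'a topology \<Rightarrow> bool" where
  "frechet_space V X \<longleftrightarrow>
     locally_convex_topology V X \<and>
     (\<exists>d. Metric_space V d \<and>
          (\<forall>x\<in>V. \<forall>y\<in>V. \<forall>z\<in>V. d (x + z) (y + z) = d x y) \<and>
          Metric_space.mcomplete V d \<and>
          X = Metric_space.mtopology V d)"

definition inductive_spectrum :: "(nat \<Rightarrow> 'a set) \<Rightarrow> (nat \<Rightarrow> 'a topology) \<Rightarrow> bool" where
  "inductive_spectrum E X \<longleftrightarrow>
     (\<forall>m. frechet_space (E m) (X m)) \<and>
     (\<forall>m. E m \<subseteq> E (Suc m) \<and> continuous_map (X m) (X (Suc m)) (\<lambda>x. x))"

definition inductive_limit_topology :: "(nat \<Rightarrow> 'a set) \<Rightarrow> (nat \<Rightarrow> 'a topology) \<Rightarrow> 'a topology \<Rightarrow> bool" where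
  "inductive_limit_topology E X T \<longleftrightarrow>
     locally_convex_topology (\<Union>m. E m) T \<and>
     (\<forall>m. continuous_map (X m) T (\<lambda>x. x)) \<and>
     (\<forall>S. locally_convex_topology (\<Union>m. E m) S \<and> (\<forall>m. continuous_map (X m) S (\<lambda>x. x)) \<longrightarrow>
          (\<forall>U. openin S U \<longrightarrow> openin T U))"

definition schauder_basis :: "'a set \<Rightarrow> 'a topology \<Rightarrow> (nat \<Rightarrow> 'a) \<Rightarrow> bool" where
  "schauder_basis V X e \<longleftrightarrow>
     range e \<subseteq> V \<and>
     (\<forall>x\<in>V. \<exists>!a. limitin X (\<lambda>n. \<Sum>j<n. scale (a j) (e j)) x sequentially)"

end

text \<open>
  The union of the steps is required to be the whole type, i.e. the type \<open>'a\<close> is the LF-space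
  itself.
\<close>

locale lf_space = rc_vector_space scale
  for scale :: "'k::{real_normed_field,euclidean_space} \<Rightarrow> 'a::ab_group_add \<Rightarrow> 'a" +
  fixes E :: "nat \<Rightarrow> 'a set" and X :: "nat \<Rightarrow> 'a topology" and T :: "'a topology"
  assumes spectrum: "inductive_spectrum E X"
    and union: "(\<Union>m. E m) = UNIV"
    and limit_topology: "inductive_limit_topology E X T"
    and hausdorff: "Hausdorff_space T"
begin

definition stepwise_schauder_basis :: "(nat \<Rightarrow> 'a) \<Rightarrow> bool" where
  "stepwise_schauder_basis e \<longleftrightarrow> range e \<subseteq> E 0 \<and> (\<forall>m. schauder_basis (E m) (X m) e)"

text \<open>
  A linear map with the prescribed values on the \<open>e j\<close> is exactly a linear extension of the shift
  on their span.
\<close>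

definition associated_backward_shift :: "(nat \<Rightarrow> 'a) \<Rightarrow> ('a \<Rightarrow> 'a) \<Rightarrow> bool" where
  "associated_backward_shift e B \<longleftrightarrow>
     Vector_Spaces.linear scale scale B \<and> continuous_map T T B \<and>
     B (e 0) = 0 \<and> (\<forall>j. B (e (Suc j)) = e j)"

end

definition mixing :: "'a topology \<Rightarrow> ('a \<Rightarrow> 'a) \<Rightarrow> bool" where
  "mixing T f \<longleftrightarrow>
     (\<forall>U V. openin T U \<and> U \<noteq> {} \<and> openin T V \<and> V \<noteq> {} \<longrightarrow>
        (\<forall>\<^sub>F n in cofinite. (f ^^ n) ` U \<inter> V \<noteq> {}))"

definition sequentially_hypercyclic :: "'a topology \<Rightarrow> ('a \<Rightarrow> 'a) \<Rightarrow> bool" where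
  "sequentially_hypercyclic T f \<longleftrightarrow>
     (\<exists>x\<in>topspace T. \<forall>y\<in>topspace T.
        \<exists>s :: nat \<Rightarrow> 'a. range s \<subseteq> range (\<lambda>n. (f ^^ n) x) \<and> limitin T s y sequentially)"

end

theory Submission
  imports Defs
begin

text \<open>
  Mixing forces the basis vectors to be small in a topological sense, and this smallness is
  already visible in a single step on arbitrarily long blocks of indices; a vector of that step
  built from such blocks has a sequentially dense orbit. Write \<open>w\<^sub>m(n)\<close> for the distance of \<open>e\<^sub>n\<close> to
  \<open>0\<close> in an invariant complete metric of the step \<open>E\<^sub>m\<close>.

  \<^emph>\<open>Banach's theorem.\<close> In each step the partial sum operators of the basis expansion are
  equicontinuous (\<open>S_equicontinuous\<close>), hence so are the coordinate projections.

  \<^emph>\<open>Mixing.\<close> For all \<open>\<epsilon>\<^sub>m > 0\<close> the set \<open>J\<close> of the \<open>n\<close> with \<open>w\<^sub>m(n) \<ge> \<epsilon>\<^sub>m\<close> for every \<open>m\<close> is finite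
  (\<open>mixing_imp_finite_large\<close>). By the equicontinuity of the projections, \<open>p(x) = sup {|x\<^sub>n| : n \<in> J}\<close>
  is a continuous seminorm on every step, hence on \<open>E\<close>. If \<open>J\<close> were infinite, mixing would send a
  point of \<open>{p < 1/2}\<close> into \<open>{|x\<^sub>0 - 1| < 1/2}\<close> by a power \<open>B\<^sup>n\<close> with \<open>n \<in> J\<close>; but the coordinate of
  index \<open>0\<close> of \<open>B\<^sup>n x\<close> is \<open>x\<^sub>n\<close>.

  \<^emph>\<open>Continuity of the shift between steps.\<close> For every \<open>r\<close> there is \<open>s\<close> such that \<open>w\<^sub>s(j)\<close> is small
  whenever \<open>w\<^sub>r(j + 1)\<close> is small (\<open>shift_step_continuous\<close>). Otherwise a gliding hump gives a vector
  \<open>x \<in> E\<^sub>r\<close>, a sum of basis vectors, for which the terms of the expansion of \<open>B x\<close> do not tend to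
  \<open>0\<close> in any step.

  \<^emph>\<open>Windows.\<close> Some step \<open>E\<^sub>m\<close> has, for all \<open>\<epsilon>\<close> and \<open>L\<close>, arbitrarily late blocks of \<open>L\<close> consecutive
  indices on which \<open>w\<^sub>m < \<epsilon>\<close> (\<open>long_small_windows\<close>). Otherwise for every \<open>m\<close> the indices with
  \<open>w\<^sub>m(n) \<ge> \<epsilon>\<^sub>m\<close>, the peaks of level \<open>m\<close>, have bounded gaps. Walking to the right from a peak of a very
  high level through peaks of decreasing levels, one reaches an index \<open>j\<close> that is not far to
  the right of a peak of each of these levels. If the levels increase fast enough, then the
  continuity of the shift between steps turns the peaks into lower bounds for \<open>w\<^sub>r(j)\<close> that do not
  depend on \<open>j\<close>. Infinitely many such \<open>j\<close> contradict the finiteness above.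

  \<^emph>\<open>The orbit.\<close> Let \<open>y\<^sub>k\<close> run infinitely often through the finite combinations of the basis with
  coefficients in a countable dense set. The windows allow one to place copies of the \<open>y\<^sub>k\<close> at
  indices \<open>n\<^sub>k\<close> such that their sum \<open>x\<close> converges in \<open>E\<^sub>m\<close> and \<open>B\<^bsup>n\<^sub>k\<^esup> x - y\<^sub>k\<close> tends to \<open>0\<close> in \<open>E\<^sub>m\<close>
  (\<open>sequentially_hypercyclic_if_small_windows\<close>).
\<close>

section \<open>Complete metrizable topological vector spaces\<close>

text \<open>
  A subspace \<open>V\<close> of the ambient space with a complete translation-invariant metric for which
  scalar multiplication is jointly continuous. Local convexity is not needed for the results on
  bases.
\<close>

locale complete_metric_tvs = rc_vector_space scale
  for scale :: "'k::{real_normed_field,euclidean_space} \<Rightarrow> 'a::ab_group_add \<Rightarrow> 'a" +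
  fixes V :: "'a set" and d :: "'a \<Rightarrow> 'a \<Rightarrow> real"
  assumes subspace_V: "subspace V"
    and metric: "Metric_space V d"
    and translation: "\<lbrakk>x \<in> V; y \<in> V; z \<in> V\<rbrakk> \<Longrightarrow> d (x + z) (y + z) = d x y"
    and complete: "Metric_space.mcomplete V d"
    and continuous_scale:
      "continuous_map (prod_topology euclidean (Metric_space.mtopology V d))
         (Metric_space.mtopology V d) (\<lambda>(c, x). scale c x)"
begin

sublocale Metric_space V d by (rule metric)

text \<open>
  The distance to \<open>0\<close>. It is subadditive and even, but in general not homogeneous, so that
  scaling arguments have to use the continuity of scalar multiplication.
\<close>

definition nr :: "'a \<Rightarrow> real" where
  "nr x = d x 0"

lemma V_closed [simp]:
  "0 \<in> V" "x \<in> V \<Longrightarrow> y \<in> V \<Longrightarrow> x + y \<in> V" "x \<in> V \<Longrightarrow> y \<in> V \<Longrightarrow> x - y \<in> V"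
  "x \<in> V \<Longrightarrow> - x \<in> V" "x \<in> V \<Longrightarrow> scale c x \<in> V"
  using subspace_V by (auto simp: subspace_0 subspace_add subspace_diff subspace_neg subspace_scale)

lemma V_sum: "(\<And>i. i \<in> I \<Longrightarrow> f i \<in> V) \<Longrightarrow> sum f I \<in> V"
  using subspace_V by (rule subspace_sum)

lemma d_eq_nr: "x \<in> V \<Longrightarrow> y \<in> V \<Longrightarrow> d x y = nr (x - y)"
  using translation[of x y "- y"] by (simp add: nr_def)

lemma nr_nonneg [simp]: "0 \<le> nr x"
  by (simp add: nr_def)

lemma nr_0 [simp]: "nr 0 = 0"
  by (simp add: nr_def)

lemma nr_eq_0_iff: "x \<in> V \<Longrightarrow> nr x = 0 \<longleftrightarrow> x = 0"
  by (simp add: nr_def)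

lemma nr_pos: "x \<in> V \<Longrightarrow> x \<noteq> 0 \<Longrightarrow> 0 < nr x"
  using nr_eq_0_iff nr_nonneg by (metis less_eq_real_def)

lemma nr_minus: "x \<in> V \<Longrightarrow> nr (- x) = nr x"
  using translation[of "- x" 0 x] by (simp add: nr_def commute)

lemma nr_minus_commute: "x \<in> V \<Longrightarrow> y \<in> V \<Longrightarrow> nr (x - y) = nr (y - x)"
  by (metis commute d_eq_nr)

lemma nr_add: "x \<in> V \<Longrightarrow> y \<in> V \<Longrightarrow> nr (x + y) \<le> nr x + nr y"
  using triangle[of "x + y" y 0] translation[of x 0 y] by (simp add: nr_def)

lemma nr_diff: "x \<in> V \<Longrightarrow> y \<in> V \<Longrightarrow> nr (x - y) \<le> nr x + nr y"
  using nr_add[of x "- y"] by (simp add: nr_minus)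

lemma nr_sum: "(\<And>i. i \<in> I \<Longrightarrow> f i \<in> V) \<Longrightarrow> nr (sum f I) \<le> (\<Sum>i\<in>I. nr (f i))"
proof (induction I rule: infinite_finite_induct)
  case (insert i I)
  then have "nr (f i + sum f I) \<le> nr (f i) + nr (sum f I)"
    by (intro nr_add V_sum) auto
  with insert show ?case by fastforce
qed auto

lemma limitin_iff_nr:
  assumes "\<And>n. f n \<in> V"
  shows "limitin mtopology f l sequentially \<longleftrightarrow> l \<in> V \<and> (\<lambda>n. nr (f n - l)) \<longlonglongrightarrow> 0"
proof -
  have "((\<lambda>n. nr (f n - l)) \<longlonglongrightarrow> 0) \<longleftrightarrow> (\<forall>\<epsilon>>0. \<forall>\<^sub>F n in sequentially. f n \<in> V \<and> d (f n) l < \<epsilon>)"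
    if "l \<in> V"
    unfolding tendsto_iff using assms that by (simp add: d_eq_nr)
  then show ?thesis
    unfolding limitin_metric by blast
qed

lemma nr_squeeze:
  assumes "\<And>n. nr (f n) \<le> g n" "g \<longlonglongrightarrow> 0"
  shows "(\<lambda>n. nr (f n)) \<longlonglongrightarrow> 0"
  by (rule tendsto_sandwich[of "\<lambda>_. 0" _ _ g]) (use assms in auto)

lemma continuous_scale_at:
  assumes "x \<in> V" "0 < \<epsilon>"
  obtains \<eta> where "0 < \<eta>"
    "\<And>c' x'. \<lbrakk>norm (c' - c) < \<eta>; x' \<in> V; nr (x' - x) < \<eta>\<rbrakk> \<Longrightarrow> nr (scale c' x' - scale c x) < \<epsilon>"
proof -
  define W where "W = {z \<in> topspace (prod_topology euclidean mtopology).
      (\<lambda>(c, x). scale c x) z \<in> mball (scale c x) \<epsilon>}"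
  have "openin (prod_topology euclidean mtopology) W"
    unfolding W_def using continuous_scale by (rule openin_continuous_map_preimage) simp
  then have *: "\<And>a b. (a, b) \<in> W \<Longrightarrow>
      \<exists>A S. openin euclidean A \<and> openin mtopology S \<and> a \<in> A \<and> b \<in> S \<and> A \<times> S \<subseteq> W"
    unfolding openin_prod_topology_alt by simp
  have "(c, x) \<in> W" using assms by (simp add: W_def)
  from *[OF this] obtain A S
    where AS: "open A" "openin mtopology S" "c \<in> A" "x \<in> S" "A \<times> S \<subseteq> W"
    unfolding open_openin[symmetric] by blast
  obtain \<eta>1 where \<eta>1: "\<eta>1 > 0" "ball c \<eta>1 \<subseteq> A"
    using AS by (meson openE)
  obtain \<eta>2 where \<eta>2: "\<eta>2 > 0" "mball x \<eta>2 \<subseteq> S"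
    using AS unfolding openin_mtopology by blast
  show thesis
  proof (rule that[of "min \<eta>1 \<eta>2"])
    fix c' x' assume *: "norm (c' - c) < min \<eta>1 \<eta>2" "x' \<in> V" "nr (x' - x) < min \<eta>1 \<eta>2"
    then have "c' \<in> A" using \<eta>1 by (auto simp: dist_norm norm_minus_commute)
    have "x' \<in> mball x \<eta>2"
      using * assms by (simp add: d_eq_nr nr_minus_commute[of x x'])
    then have "x' \<in> S"
      using \<eta>2 by blast
    with \<open>c' \<in> A\<close> have "(c', x') \<in> W" using AS by blast
    then show "nr (scale c' x' - scale c x) < \<epsilon>"
      using * assms by (simp add: W_def d_eq_nr nr_minus_commute[of "scale c x"])
  qed (use \<eta>1 \<eta>2 in auto)
qed

text \<open>Multiplication by scalars from a bounded set is equicontinuous at \<open>0\<close>.\<close>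

lemma scale_bounded_small:
  assumes "0 < \<epsilon>"
  obtains \<delta> where "0 < \<delta>"
    "\<And>(c::'k) x. \<lbrakk>norm c \<le> K; x \<in> V; nr x < \<delta>\<rbrakk> \<Longrightarrow> nr (scale c x) < \<epsilon>"
proof -
  obtain \<eta> where \<eta>: "\<eta> > 0" "\<And>(c::'k) x. norm c < \<eta> \<Longrightarrow> x \<in> V \<Longrightarrow> nr x < \<eta> \<Longrightarrow> nr (scale c x) < \<epsilon>"
    using continuous_scale_at[of 0 \<epsilon> 0] assms by auto
  define t :: 'k where "t = of_real ((\<bar>K\<bar> + 1) / (\<eta> / 2))"
  have t: "t \<noteq> 0" "norm t = (\<bar>K\<bar> + 1) / (\<eta> / 2)"
    unfolding t_def using \<eta>(1) by (auto simp del: of_real_divide)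
  obtain \<delta> where \<delta>: "\<delta> > 0" "\<And>c' x. norm (c' - t) < \<delta> \<Longrightarrow> x \<in> V \<Longrightarrow> nr x < \<delta> \<Longrightarrow> nr (scale c' x) < \<eta>"
    using continuous_scale_at[of 0 \<eta> t] \<eta>(1) by auto
  show thesis
  proof (rule that[OF \<delta>(1)])
    fix c :: 'k and x assume *: "norm c \<le> K" "x \<in> V" "nr x < \<delta>"
    have "norm c * (\<eta> / 2) < (\<bar>K\<bar> + 1) * \<eta>"
      using *(1) \<eta>(1) by (intro mult_strict_mono) auto
    then have "norm (c / t) < \<eta>"
      unfolding norm_divide t(2) using \<eta>(1) by (simp add: divide_less_eq mult.commute)
    moreover have "nr (scale t x) < \<eta>" using \<delta> * by simp
    ultimately have "nr (scale (c / t) (scale t x)) < \<epsilon>" using * by (intro \<eta>(2)) auto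
    then show "nr (scale c x) < \<epsilon>" using t(1) by simp
  qed
qed

lemma scale_vector_small:
  assumes "x \<in> V" "0 < \<epsilon>"
  obtains \<eta> where "0 < \<eta>" "\<And>c. norm c < \<eta> \<Longrightarrow> nr (scale c x) < \<epsilon>"
proof -
  obtain \<eta> where \<eta>: "0 < \<eta>"
    "\<And>c' x'. \<lbrakk>norm (c' - 0) < \<eta>; x' \<in> V; nr (x' - x) < \<eta>\<rbrakk> \<Longrightarrow> nr (scale c' x' - scale 0 x) < \<epsilon>"
    using continuous_scale_at[OF assms, where c = 0] by blast
  show thesis
    by (rule that[OF \<eta>(1)]) (use \<eta>(2)[of _ x] \<eta>(1) assms in simp)
qed

lemma scale_absorb:
  assumes "x \<in> V" "0 < \<epsilon>"
  obtains t :: real where "0 < t" "nr (scale (of_real t) x) < \<epsilon>"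
proof -
  obtain \<eta> where \<eta>: "0 < \<eta>" "\<And>c. norm c < \<eta> \<Longrightarrow> nr (scale c x) < \<epsilon>"
    using scale_vector_small[OF assms] by blast
  show thesis by (rule that[of "\<eta> / 2"]) (use \<eta> in auto)
qed

text \<open>On the line spanned by a nonzero vector, small vectors have small coefficients.\<close>

lemma coefficient_small:
  assumes "v \<in> V" "v \<noteq> 0" "0 < \<epsilon>"
  obtains \<delta> where "0 < \<delta>" "\<And>c. nr (scale c v) < \<delta> \<Longrightarrow> norm c < \<epsilon>"
proof -
  have pos: "0 < nr v" using assms nr_pos by simp
  obtain \<delta> where \<delta>: "0 < \<delta>" "\<And>c x. norm c \<le> 1 / \<epsilon> \<Longrightarrow> x \<in> V \<Longrightarrow> nr x < \<delta> \<Longrightarrow> nr (scale c x) < nr v"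
    using scale_bounded_small[OF pos, where K = "1 / \<epsilon>"] by blast
  show thesis
  proof (rule that[OF \<delta>(1)], rule ccontr)
    fix c assume c: "nr (scale c v) < \<delta>" "\<not> norm c < \<epsilon>"
    then have "c \<noteq> 0" using assms(3) by auto
    moreover have "norm (inverse c) \<le> 1 / \<epsilon>"
      unfolding norm_inverse using le_imp_inverse_le[of \<epsilon> "norm c"] c(2) assms(3)
      by (simp add: inverse_eq_divide)
    ultimately show False
      using \<delta>(2)[of "inverse c" "scale c v"] c(1) assms by simp
  qed
qed

lemma geometric_sum_bound: "(\<Sum>i\<in>{l..<k}. (1/2::real) ^ i) \<le> 2 * (1/2) ^ l"
proof (cases "l \<le> k")
  case True
  then have "(\<Sum>i\<in>{l..<k}. (1/2::real) ^ i) = 2 * (1/2) ^ l - 2 * (1/2) ^ k"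
    by (induction rule: dec_induct) auto
  then show ?thesis by simp
qed auto

lemma geometric_series_converges:
  assumes g: "\<And>i. g i \<in> V" and small: "\<And>i. nr (g i) \<le> C * (1/2) ^ i"
  obtains x where "x \<in> V" "\<And>l. nr ((\<Sum>i<l. g i) - x) \<le> 2 * C * (1/2) ^ l"
proof -
  let ?z = "\<lambda>k. \<Sum>i<k. g i"
  have C: "0 \<le> C" using order_trans[OF nr_nonneg small[of 0]] by simp
  have zV: "?z k \<in> V" for k using g by (intro V_sum)
  have diff: "nr (?z k - ?z l) \<le> 2 * C * (1/2) ^ l" if "l \<le> k" for k l
  proof -
    have "?z k - ?z l = (\<Sum>i\<in>{l..<k}. g i)"
      using sum_diff_nat_ivl[of 0 l k g] that by (simp add: atLeast0LessThan)
    also have "nr \<dots> \<le> (\<Sum>i\<in>{l..<k}. nr (g i))" using g by (intro nr_sum) auto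
    also have "\<dots> \<le> (\<Sum>i\<in>{l..<k}. C * (1/2) ^ i)" by (intro sum_mono small)
    also have "\<dots> = C * (\<Sum>i\<in>{l..<k}. (1/2) ^ i)" by (simp add: sum_distrib_left)
    also have "\<dots> \<le> C * (2 * (1/2) ^ l)" using C by (intro mult_left_mono geometric_sum_bound)
    finally show ?thesis by simp
  qed
  have lim0: "(\<lambda>l. 2 * C * (1/2::real) ^ l) \<longlonglongrightarrow> 0"
    by (intro tendsto_mult_right_zero LIMSEQ_power_zero) simp
  have "MCauchy ?z"
    unfolding MCauchy_def
  proof (intro conjI allI impI)
    fix \<epsilon> :: real assume "0 < \<epsilon>"
    then obtain N where N: "2 * C * (1/2) ^ N < \<epsilon> / 2"
      using order_tendstoD(2)[OF lim0, of "\<epsilon>/2"] by (auto simp: eventually_sequentially)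
    have "d (?z n) (?z n') < \<epsilon>" if "N \<le> n" "N \<le> n'" for n n'
      using triangle[of "?z n" "?z N" "?z n'"] diff[OF that(1)] diff[OF that(2)] N zV
      by (simp add: d_eq_nr nr_minus_commute)
    then show "\<exists>N. \<forall>n n'. N \<le> n \<longrightarrow> N \<le> n' \<longrightarrow> d (?z n) (?z n') < \<epsilon>" by blast
  qed (use zV in auto)
  then obtain x where "limitin mtopology ?z x sequentially"
    using complete unfolding mcomplete_def by blast
  then have x: "x \<in> V" "(\<lambda>k. nr (?z k - x)) \<longlonglongrightarrow> 0"
    using limitin_iff_nr[OF zV] by auto
  have "nr (?z l - x) \<le> 2 * C * (1/2) ^ l" for l
  proof (rule field_le_epsilon)
    fix \<epsilon> :: real assume "0 < \<epsilon>"
    then have "\<forall>\<^sub>F k in sequentially. nr (?z k - x) < \<epsilon>"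
      using order_tendstoD(2)[OF x(2)] by blast
    then obtain k where k: "l \<le> k" "nr (?z k - x) < \<epsilon>"
      unfolding eventually_sequentially by (meson nle_le)
    have "nr (?z l - x) \<le> nr (?z l - ?z k) + nr (?z k - x)"
      using nr_add[of "?z l - ?z k" "?z k - x"] zV x by simp
    also have "\<dots> \<le> 2 * C * (1/2) ^ l + \<epsilon>"
      using diff[OF k(1)] k(2) zV by (simp add: nr_minus_commute[of "?z l"])
    finally show "nr (?z l - x) \<le> 2 * C * (1/2) ^ l + \<epsilon>" .
  qed
  with x(1) show thesis by (rule that)
qed

corollary geometric_series_limitin:
  assumes g: "\<And>i. g i \<in> V" and small: "\<And>i. nr (g i) \<le> C * (1/2) ^ i"
  obtains x where "limitin mtopology (\<lambda>k. \<Sum>i<k. g i) x sequentially" "nr x \<le> 2 * C"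
proof -
  obtain x where x: "x \<in> V" "\<And>l. nr ((\<Sum>i<l. g i) - x) \<le> 2 * C * (1/2) ^ l"
    using geometric_series_converges[OF assms] by blast
  have "(\<lambda>l. 2 * C * (1/2::real) ^ l) \<longlonglongrightarrow> 0"
    by (intro tendsto_mult_right_zero LIMSEQ_power_zero) simp
  then have "(\<lambda>l. nr ((\<Sum>i<l. g i) - x)) \<longlonglongrightarrow> 0"
    by (rule nr_squeeze[OF x(2)])
  then have "limitin mtopology (\<lambda>k. \<Sum>i<k. g i) x sequentially"
    using x(1) g by (simp add: limitin_iff_nr V_sum)
  moreover have "nr x \<le> 2 * C" using x(2)[of 0] x(1) by (simp add: nr_minus)
  ultimately show thesis by (rule that)
qed

lemma limitin_add:
  assumes "limitin mtopology f x sequentially" "limitin mtopology g y sequentially"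
    and f: "\<And>n. f n \<in> V" and g: "\<And>n. g n \<in> V"
  shows "limitin mtopology (\<lambda>n. f n + g n) (x + y) sequentially"
proof -
  have x: "x \<in> V" "(\<lambda>n. nr (f n - x)) \<longlonglongrightarrow> 0" and y: "y \<in> V" "(\<lambda>n. nr (g n - y)) \<longlonglongrightarrow> 0"
    using assms by (simp_all add: limitin_iff_nr)
  have "nr (f n + g n - (x + y)) \<le> nr (f n - x) + nr (g n - y)" for n
    using nr_add[of "f n - x" "g n - y"] x y f g by (simp add: algebra_simps)
  moreover have "(\<lambda>n. nr (f n - x) + nr (g n - y)) \<longlonglongrightarrow> 0"
    using tendsto_add[OF x(2) y(2)] by simp
  ultimately have "(\<lambda>n. nr (f n + g n - (x + y))) \<longlonglongrightarrow> 0"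
    by (rule nr_squeeze)
  then show ?thesis using x y f g by (simp add: limitin_iff_nr)
qed

lemma combination_small:
  fixes b :: "nat \<Rightarrow> 'k"
  assumes "0 < \<epsilon>"
  shows "\<exists>\<delta>>0. \<forall>z. (\<forall>i<n. z i \<in> V \<and> nr (z i) < \<delta>) \<longrightarrow> nr (\<Sum>i<n. scale (b i) (z i)) < \<epsilon>"
  using assms
proof (induction n arbitrary: \<epsilon>)
  case 0
  then show ?case by (intro exI[of _ 1]) simp
next
  case (Suc n)
  then have half: "0 < \<epsilon> / 2" by simp
  obtain \<delta>1 where \<delta>1: "0 < \<delta>1"
    "\<And>z. (\<forall>i<n. z i \<in> V \<and> nr (z i) < \<delta>1) \<Longrightarrow> nr (\<Sum>i<n. scale (b i) (z i)) < \<epsilon> / 2"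
    using Suc.IH[OF half] by blast
  obtain \<delta>2 where \<delta>2: "0 < \<delta>2"
    "\<And>(c::'k) x. \<lbrakk>norm c \<le> norm (b n); x \<in> V; nr x < \<delta>2\<rbrakk> \<Longrightarrow> nr (scale c x) < \<epsilon> / 2"
    using scale_bounded_small[OF half, where K = "norm (b n)"] by blast
  have "nr (\<Sum>i<Suc n. scale (b i) (z i)) < \<epsilon>"
    if z: "\<forall>i<Suc n. z i \<in> V \<and> nr (z i) < min \<delta>1 \<delta>2" for z
  proof -
    have "nr (\<Sum>i<Suc n. scale (b i) (z i)) \<le> nr (\<Sum>i<n. scale (b i) (z i)) + nr (scale (b n) (z n))"
      unfolding sum.lessThan_Suc using z by (intro nr_add V_sum) auto
    moreover have "nr (\<Sum>i<n. scale (b i) (z i)) < \<epsilon> / 2"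
      using z by (intro \<delta>1(2)) auto
    moreover have "nr (scale (b n) (z n)) < \<epsilon> / 2"
      using z by (intro \<delta>2(2)) auto
    ultimately show ?thesis by simp
  qed
  then show ?case using \<delta>1(1) \<delta>2(1) by (intro exI[of _ "min \<delta>1 \<delta>2"]) simp
qed

text \<open>Lines are closed: a limit of multiples of \<open>v\<close> is a multiple of \<open>v\<close>.\<close>

lemma line_closed:
  assumes v: "v \<in> V" "v \<noteq> 0" and u: "u \<in> V"
    and lim: "(\<lambda>k. nr (scale (c k) v - u)) \<longlonglongrightarrow> 0"
  obtains b where "u = scale b v"
proof -
  have "Cauchy c"
    unfolding Cauchy_def
  proof (intro allI impI)
    fix \<epsilon> :: real assume "0 < \<epsilon>"
    then obtain \<delta> where \<delta>: "0 < \<delta>" "\<And>c. nr (scale c v) < \<delta> \<Longrightarrow> norm c < \<epsilon>"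
      using coefficient_small[OF v] by blast
    then obtain N where N: "\<And>k. k \<ge> N \<Longrightarrow> nr (scale (c k) v - u) < \<delta> / 2"
      using order_tendstoD(2)[OF lim, of "\<delta> / 2"] unfolding eventually_sequentially by auto
    have "dist (c k) (c l) < \<epsilon>" if "k \<ge> N" "l \<ge> N" for k l
    proof -
      have "scale (c k - c l) v = (scale (c k) v - u) - (scale (c l) v - u)"
        by (simp add: scale_left_diff_distrib)
      then have "nr (scale (c k - c l) v) \<le> nr (scale (c k) v - u) + nr (scale (c l) v - u)"
        using nr_diff[of "scale (c k) v - u" "scale (c l) v - u"] v u by (simp only:) auto
      also have "\<dots> < \<delta>" using N[OF that(1)] N[OF that(2)] by simp
      finally show ?thesis by (simp add: \<delta>(2) dist_norm)
    qed
    then show "\<exists>N. \<forall>k\<ge>N. \<forall>l\<ge>N. dist (c k) (c l) < \<epsilon>" by blast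
  qed
  then obtain b where b: "c \<longlonglongrightarrow> b"
    using Cauchy_convergent_iff convergent_def by blast
  have "nr (scale b v - u) \<le> 0"
  proof (rule field_le_epsilon)
    fix \<epsilon> :: real assume \<epsilon>: "0 < \<epsilon>"
    then obtain \<eta> where \<eta>: "0 < \<eta>" "\<And>c. norm c < \<eta> \<Longrightarrow> nr (scale c v) < \<epsilon> / 2"
      using scale_vector_small[OF v(1), of "\<epsilon> / 2"] half_gt_zero by blast
    have "\<forall>\<^sub>F k in sequentially. dist (c k) b < \<eta> \<and> nr (scale (c k) v - u) < \<epsilon> / 2"
      using \<epsilon> \<eta>(1) by (intro eventually_conj tendstoD[OF b] order_tendstoD(2)[OF lim]) auto
    then obtain k where k: "dist (c k) b < \<eta>" "nr (scale (c k) v - u) < \<epsilon> / 2"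
      unfolding eventually_sequentially by blast
    have "scale b v - u = (scale (c k) v - u) - scale (c k - b) v"
      by (simp add: scale_left_diff_distrib)
    then have "nr (scale b v - u) \<le> nr (scale (c k) v - u) + nr (scale (c k - b) v)"
      using nr_diff[of "scale (c k) v - u" "scale (c k - b) v"] v u by (simp only:) auto
    also have "\<dots> \<le> 0 + \<epsilon>" using k(2) \<eta>(2)[of "c k - b"] k(1) by (simp add: dist_norm)
    finally show "nr (scale b v - u) \<le> 0 + \<epsilon>" .
  qed
  then have "nr (scale b v - u) = 0" using nr_nonneg[of "scale b v - u"] by linarith
  then have "scale b v - u = 0" by (rule nr_eq_0_iff[THEN iffD1, rotated]) (use v u in simp)
  then show thesis by (intro that[of b]) simp
qed

end


section \<open>Banach's theorem on Schauder bases\<close>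

locale step_with_basis = complete_metric_tvs scale V d
  for scale :: "'k::{real_normed_field,euclidean_space} \<Rightarrow> 'a::ab_group_add \<Rightarrow> 'a" and V d +
  fixes e :: "nat \<Rightarrow> 'a"
  assumes basis: "schauder_basis V mtopology e"
begin

text \<open>
  The coefficients of the basis expansion and its partial sums; \<open>S n\<close> has \<open>n\<close> terms. Their
  continuity is not part of the definition of a Schauder basis.
\<close>

definition coef :: "'a \<Rightarrow> nat \<Rightarrow> 'k" where
  "coef x = (THE a. limitin mtopology (\<lambda>n. \<Sum>j<n. scale (a j) (e j)) x sequentially)"

definition S :: "nat \<Rightarrow> 'a \<Rightarrow> 'a" where
  "S n x = (\<Sum>j<n. scale (coef x j) (e j))"

lemma e_in [simp]: "e j \<in> V"
  using basis by (auto simp: schauder_basis_def)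

lemma combination_in [simp]: "(\<Sum>j\<in>J. scale (a j) (e j)) \<in> V"
  by (intro V_sum) simp

lemma S_in [simp]: "S n x \<in> V"
  by (simp add: S_def)

lemma ex1_expansion:
  "x \<in> V \<Longrightarrow> \<exists>!a. limitin mtopology (\<lambda>n. \<Sum>j<n. scale (a j) (e j)) x sequentially"
  using basis by (auto simp: schauder_basis_def)

lemma expansion: "x \<in> V \<Longrightarrow> limitin mtopology (\<lambda>n. S n x) x sequentially"
  unfolding S_def coef_def by (rule theI'[OF ex1_expansion])

lemma S_converges: "x \<in> V \<Longrightarrow> (\<lambda>n. nr (S n x - x)) \<longlonglongrightarrow> 0"
  using expansion limitin_iff_nr[of "\<lambda>n. S n x"] by auto

lemma coef_eqI_limitin:
  assumes "limitin mtopology (\<lambda>n. \<Sum>j<n. scale (b j) (e j)) x sequentially"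
  shows "coef x = b"
  unfolding coef_def using ex1_expansion limitin_mspace[OF assms] assms by (intro the1_equality) auto

lemma coef_eqI:
  assumes "x \<in> V" "(\<lambda>n. nr ((\<Sum>j<n. scale (b j) (e j)) - x)) \<longlonglongrightarrow> 0"
  shows "coef x = b"
  using assms by (intro coef_eqI_limitin) (simp add: limitin_iff_nr)

lemma coef_combination: "coef (\<Sum>j<n. scale (b j) (e j)) = (\<lambda>j. if j < n then b j else 0)"
proof (rule coef_eqI)
  have "(\<Sum>j<m. scale (if j < n then b j else 0) (e j)) = (\<Sum>j<n. scale (b j) (e j))" if "n \<le> m" for m
    using that by (intro sum.mono_neutral_cong_right) auto
  then have "\<forall>\<^sub>F m in sequentially. nr ((\<Sum>j<m. scale (if j < n then b j else 0) (e j))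
      - (\<Sum>j<n. scale (b j) (e j))) = 0"
    unfolding eventually_sequentially by (intro exI[of _ n]) simp
  then show "(\<lambda>m. nr ((\<Sum>j<m. scale (if j < n then b j else 0) (e j))
      - (\<Sum>j<n. scale (b j) (e j)))) \<longlonglongrightarrow> 0"
    by (rule tendsto_eventually)
qed auto

lemma coef_diff:
  assumes "x \<in> V" "y \<in> V"
  shows "coef (x - y) = (\<lambda>j. coef x j - coef y j)"
proof (rule coef_eqI)
  have "(\<Sum>j<n. scale (coef x j - coef y j) (e j)) - (x - y) = (S n x - x) - (S n y - y)" for n
    by (simp add: S_def scale_left_diff_distrib sum_subtractf algebra_simps)
  then have "nr ((\<Sum>j<n. scale (coef x j - coef y j) (e j)) - (x - y)) \<le> nr (S n x - x) + nr (S n y - y)" for n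
    using nr_diff[of "S n x - x" "S n y - y"] assms by (simp only:) auto
  moreover have "(\<lambda>n. nr (S n x - x) + nr (S n y - y)) \<longlonglongrightarrow> 0"
    using tendsto_add[OF S_converges S_converges] assms by fastforce
  ultimately show "(\<lambda>n. nr ((\<Sum>j<n. scale (coef x j - coef y j) (e j)) - (x - y))) \<longlonglongrightarrow> 0"
    by (rule nr_squeeze)
qed (use assms in auto)

lemma coef_scale:
  assumes "x \<in> V"
  shows "coef (scale c x) = (\<lambda>j. c * coef x j)"
proof (rule coef_eqI)
  have eq: "(\<Sum>j<n. scale (c * coef x j) (e j)) - scale c x = scale c (S n x - x)" for n
    by (simp add: S_def scale_right_diff_distrib scale_sum_right)
  show "(\<lambda>n. nr ((\<Sum>j<n. scale (c * coef x j) (e j)) - scale c x)) \<longlonglongrightarrow> 0"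
    unfolding eq tendsto_iff
  proof (intro allI impI)
    fix \<epsilon> :: real assume "0 < \<epsilon>"
    then obtain \<delta> where \<delta>: "0 < \<delta>" "\<And>(c'::'k) x. \<lbrakk>norm c' \<le> norm c; x \<in> V; nr x < \<delta>\<rbrakk> \<Longrightarrow> nr (scale c' x) < \<epsilon>"
      using scale_bounded_small[where K = "norm c"] by blast
    show "\<forall>\<^sub>F n in sequentially. dist (nr (scale c (S n x - x))) 0 < \<epsilon>"
      using order_tendstoD(2)[OF S_converges[OF assms] \<delta>(1)]
      by eventually_elim (use \<delta>(2)[of c] assms in auto)
  qed
qed (use assms in auto)

lemma S_diff: "x \<in> V \<Longrightarrow> y \<in> V \<Longrightarrow> S n (x - y) = S n x - S n y"
  by (simp add: S_def coef_diff scale_left_diff_distrib sum_subtractf)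

lemma S_scale: "x \<in> V \<Longrightarrow> S n (scale c x) = scale c (S n x)"
  by (simp add: S_def coef_scale scale_sum_right)

lemma coef_0 [simp]: "coef 0 j = 0"
  using coef_diff[of 0 0] by simp

lemma S_0 [simp]: "S n 0 = 0"
  by (simp add: S_def)

lemma S_minus: "x \<in> V \<Longrightarrow> S n (- x) = - S n x"
  using S_diff[of 0 x n] by simp

lemma S_add: "x \<in> V \<Longrightarrow> y \<in> V \<Longrightarrow> S n (x + y) = S n x + S n y"
  using S_diff[of x "- y" n] by (simp add: S_minus)

lemma S_sum: "(\<And>i. i \<in> I \<Longrightarrow> f i \<in> V) \<Longrightarrow> S n (sum f I) = (\<Sum>i\<in>I. S n (f i))"
proof (induction I rule: infinite_finite_induct)
  case (insert i I)
  then have "S n (f i + sum f I) = S n (f i) + S n (sum f I)"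
    by (intro S_add V_sum) auto
  with insert show ?case by simp
qed auto

lemma S_Suc_diff: "S (Suc n) x - S n x = scale (coef x n) (e n)"
  by (simp add: S_def)

lemma terms_converge_to_0:
  assumes "x \<in> V"
  shows "(\<lambda>n. nr (scale (coef x n) (e n))) \<longlonglongrightarrow> 0"
proof (rule nr_squeeze)
  fix n
  have "scale (coef x n) (e n) = (S (Suc n) x - x) - (S n x - x)"
    by (simp add: S_Suc_diff[symmetric])
  then show "nr (scale (coef x n) (e n)) \<le> nr (S (Suc n) x - x) + nr (S n x - x)"
    using nr_diff[of "S (Suc n) x - x" "S n x - x"] assms by (simp only:) auto
  show "(\<lambda>n. nr (S (Suc n) x - x) + nr (S n x - x)) \<longlonglongrightarrow> 0"
    using tendsto_add[OF LIMSEQ_Suc[OF S_converges[OF assms]] S_converges[OF assms]] by simp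
qed

lemma e_nonzero: "e k \<noteq> 0"
proof
  assume "e k = 0"
  then have "(\<Sum>j<Suc k. scale (if j = k then 1 else 0) (e j)) = 0"
    by (intro sum.neutral) auto
  then have "coef 0 k = 1"
    using fun_cong[OF coef_combination[where n = "Suc k" and b = "\<lambda>j. if j = k then 1 else 0"], of k]
    by simp
  then show False by simp
qed

text \<open>The vectors whose partial sums are all \<open>\<epsilon>\<close>-small.\<close>

definition small_sums :: "real \<Rightarrow> 'a set" where
  "small_sums \<epsilon> = {x \<in> V. \<forall>n. nr (S n x) \<le> \<epsilon>}"

lemma small_sums_absorbing:
  assumes x: "x \<in> V" and \<epsilon>: "0 < \<epsilon>"
  obtains N where "0 < N" "scale (inverse (of_nat N)) x \<in> small_sums \<epsilon>"
proof -
  obtain \<delta> where \<delta>: "0 < \<delta>" "\<And>(c::'k) x. \<lbrakk>norm c \<le> 1; x \<in> V; nr x < \<delta>\<rbrakk> \<Longrightarrow> nr (scale c x) < \<epsilon> / 2"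
    using scale_bounded_small[where K = 1 and \<epsilon> = "\<epsilon> / 2"] \<epsilon> half_gt_zero by blast
  obtain m where m: "\<And>n. n \<ge> m \<Longrightarrow> nr (S n x - x) < \<delta>"
    using order_tendstoD(2)[OF S_converges[OF x] \<delta>(1)] unfolding eventually_sequentially by blast
  let ?c = "\<lambda>N. inverse (of_nat N) :: 'k"
  have c0: "(\<lambda>N. norm (?c N)) \<longlonglongrightarrow> 0"
    using LIMSEQ_inverse_real_of_nat by (simp add: norm_inverse lim_inverse_n)
  have ev: "\<forall>\<^sub>F N in sequentially. nr (scale (?c N) v) < \<epsilon> / 2" if v: "v \<in> V" for v
  proof -
    have "0 < \<epsilon> / 2" using \<epsilon> by simp
    then obtain \<eta> where \<eta>: "0 < \<eta>" "\<And>c. norm c < \<eta> \<Longrightarrow> nr (scale c v) < \<epsilon> / 2"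
      using scale_vector_small[OF v] by blast
    show ?thesis
      using order_tendstoD(2)[OF c0 \<eta>(1)] by eventually_elim (use \<eta>(2) in auto)
  qed
  have "\<forall>\<^sub>F N in sequentially. N > 0 \<and> nr (scale (?c N) x) < \<epsilon> / 2
      \<and> (\<forall>n\<in>{..<m}. nr (scale (?c N) (S n x)) < \<epsilon> / 2)"
    by (intro eventually_conj ev x eventually_gt_at_top eventually_ball_finite ballI S_in) auto
  then obtain N where N: "N > 0" "nr (scale (?c N) x) < \<epsilon> / 2"
      "\<And>n. n < m \<Longrightarrow> nr (scale (?c N) (S n x)) < \<epsilon> / 2"
    unfolding eventually_sequentially by blast
  have "nr (S n (scale (?c N) x)) \<le> \<epsilon>" for n
  proof (cases "n < m")
    case True
    then show ?thesis using N(3)[OF True] x \<epsilon> by (simp add: S_scale)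
  next
    case False
    have "norm (?c N) \<le> 1" using N(1) by (simp add: norm_inverse inverse_le_1_iff)
    then have "nr (scale (?c N) (S n x - x)) < \<epsilon> / 2"
      using False m x by (intro \<delta>(2)) auto
    moreover have "S n (scale (?c N) x) = scale (?c N) (S n x - x) + scale (?c N) x"
      using x by (simp add: S_scale scale_right_diff_distrib)
    ultimately show ?thesis
      using nr_add[of "scale (?c N) (S n x - x)" "scale (?c N) x"] N(2) x by simp
  qed
  then show thesis
    using N(1) x by (intro that[of N]) (auto simp: small_sums_def)
qed

lemma small_sums_diff: "x \<in> small_sums \<epsilon> \<Longrightarrow> y \<in> small_sums \<delta> \<Longrightarrow> x - y \<in> small_sums (\<epsilon> + \<delta>)"
  unfolding small_sums_def
  by (auto simp: S_diff intro!: order_trans[OF nr_diff[OF S_in S_in]] add_mono)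

text \<open>
  By Baire's theorem the closure of \<open>small_sums \<epsilon>\<close> is a neighbourhood of \<open>0\<close>: the multiples
  of \<open>small_sums (\<epsilon> / 2)\<close> by positive integers cover \<open>V\<close>, so the closure of one of them has an
  interior point, and differences of elements of \<open>small_sums (\<epsilon> / 2)\<close> lie in \<open>small_sums \<epsilon>\<close>.
\<close>

lemma closure_small_sums_neighbourhood:
  assumes \<epsilon>: "0 < \<epsilon>"
  obtains \<rho> where "0 < \<rho>"
    "\<And>y \<eta>. \<lbrakk>y \<in> V; nr y < \<rho>; 0 < \<eta>\<rbrakk> \<Longrightarrow> \<exists>g\<in>small_sums \<epsilon>. nr (y - g) < \<eta>"
proof -
  let ?H = "\<lambda>N. (\<lambda>g. scale (of_nat (Suc N)) g) ` small_sums (\<epsilon> / 2)"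
  let ?C = "\<lambda>N. mtopology closure_of (?H N)"
  have cover: "V \<subseteq> (\<Union>N. ?C N)"
  proof
    fix x assume x: "x \<in> V"
    obtain N where N: "0 < N" "scale (inverse (of_nat N)) x \<in> small_sums (\<epsilon> / 2)"
      using small_sums_absorbing[OF x, of "\<epsilon> / 2"] \<epsilon> by auto
    then obtain M where M: "N = Suc M" by (cases N) auto
    have "x = scale (of_nat (Suc M)) (scale (inverse (of_nat N)) x)"
      using N(1) M by (simp del: of_nat_Suc)
    then have "x \<in> ?H M" using N(2) by blast
    moreover have "?H M \<subseteq> topspace mtopology" by (auto simp: small_sums_def)
    ultimately have "x \<in> ?C M" using closure_of_subset by blast
    then show "x \<in> (\<Union>N. ?C N)" by blast
  qed
  have "\<exists>N. mtopology interior_of ?C N \<noteq> {}"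
  proof (rule ccontr)
    assume no: "\<nexists>N. mtopology interior_of ?C N \<noteq> {}"
    have "mtopology interior_of \<Union>(range ?C) = {}"
      using no by (intro metric_Baire_category_alt complete) auto
    moreover have "V = mtopology interior_of V"
      by (metis interior_of_topspace topspace_mtopology)
    moreover have "\<Union>(range ?C) = V"
      using cover closure_of_subset_topspace by fastforce
    ultimately have "V = {}" by simp
    then show False using V_closed(1) by blast
  qed
  then obtain N x0 where "x0 \<in> mtopology interior_of ?C N" by blast
  then obtain r where r: "r > 0" "mball x0 r \<subseteq> ?C N" and x0: "x0 \<in> V"
    by (meson in_interior_of_mball in_mono interior_of_subset_topspace topspace_mtopology)
  define K where "K = (of_nat (Suc N) :: 'k)"
  have K: "K \<noteq> 0" unfolding K_def by (simp del: of_nat_Suc)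
  have approx: "\<exists>g\<in>small_sums (\<epsilon> / 2). nr (z - scale K g) < \<eta>" if z: "z \<in> V" "nr (z - x0) < r" "0 < \<eta>" for z \<eta>
  proof -
    have "z \<in> mball x0 r" using z x0 by (simp add: d_eq_nr nr_minus_commute[of x0])
    then have "z \<in> ?C N" using r by blast
    then obtain h where "h \<in> ?H N" "h \<in> mball z \<eta>"
      using z(3) unfolding metric_closure_of by blast
    then show ?thesis unfolding K_def by (auto simp: d_eq_nr)
  qed
  obtain g0 where g0: "g0 \<in> small_sums (\<epsilon> / 2)" "nr (x0 - scale K g0) < r / 2"
    using approx[of x0 "r / 2"] x0 r by auto
  have g0V: "g0 \<in> V" using g0(1) by (simp add: small_sums_def)
  obtain \<rho> where \<rho>: "0 < \<rho>" "\<And>(c::'k) x. \<lbrakk>norm c \<le> norm K; x \<in> V; nr x < \<rho>\<rbrakk> \<Longrightarrow> nr (scale c x) < r / 2"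
    using scale_bounded_small[where K = "norm K" and \<epsilon> = "r / 2"] r half_gt_zero by blast
  show thesis
  proof (rule that[OF \<rho>(1)])
    fix y \<eta> assume y: "y \<in> V" "nr y < \<rho>" and \<eta>: "0 < (\<eta>::real)"
    obtain \<delta> where \<delta>: "0 < \<delta>" "\<And>(c::'k) x. \<lbrakk>norm c \<le> norm (inverse K); x \<in> V; nr x < \<delta>\<rbrakk> \<Longrightarrow> nr (scale c x) < \<eta>"
      using scale_bounded_small[where K = "norm (inverse K)" and \<epsilon> = \<eta>] \<eta> by blast
    \<comment> \<open>A point of the ball around \<open>x0\<close>; approximating it by \<open>K g\<close> approximates \<open>y\<close> by \<open>g - g0\<close>.\<close>
    let ?z = "scale K g0 + scale K y"
    have "?z - x0 = scale K y - (x0 - scale K g0)" by simp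
    then have "nr (?z - x0) \<le> nr (scale K y) + nr (x0 - scale K g0)"
      using x0 g0V y(1) by (metis nr_diff V_closed(3,5))
    also have "\<dots> < r / 2 + r / 2"
      using g0(2) \<rho>(2)[OF order_refl y] by simp
    finally obtain g where g: "g \<in> small_sums (\<epsilon> / 2)" "nr (?z - scale K g) < \<delta>"
      using approx[of ?z \<delta>] g0V y \<delta>(1) by auto
    have gV: "g \<in> V" using g(1) by (simp add: small_sums_def)
    have "nr (scale (inverse K) (?z - scale K g)) < \<eta>"
      using g(2) gV g0V y(1) by (intro \<delta>(2)) auto
    moreover have "scale (inverse K) (?z - scale K g) = y - (g - g0)"
      using K by (simp add: scale_right_diff_distrib scale_right_distrib)
    moreover have "g - g0 \<in> small_sums \<epsilon>"
      using small_sums_diff[OF g(1) g0(1)] by simp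
    ultimately show "\<exists>g\<in>small_sums \<epsilon>. nr (y - g) < \<eta>" by metis
  qed
qed

text \<open>
  Successive approximation removes the closure. A small \<open>y\<close> is a sum of vectors \<open>g\<^sub>i\<close> whose
  partial sums in the basis are bounded by \<open>\<epsilon> / 2\<^bsup>i+1\<^esup>\<close>. The continuity of \<open>S n\<close> is not yet
  available to exchange it with the sum; instead, the vectors \<open>w n = \<Sum>\<^sub>i S n g\<^sub>i\<close> are shown to be the
  partial sums of a series in the \<open>e\<^sub>j\<close> that converges to \<open>y\<close>, and uniqueness of the expansion gives
  \<open>S n y = w n\<close>.
\<close>

theorem S_equicontinuous:
  assumes \<epsilon>: "0 < \<epsilon>"
  obtains \<delta> where "0 < \<delta>" "\<And>n x. \<lbrakk>x \<in> V; nr x < \<delta>\<rbrakk> \<Longrightarrow> nr (S n x) \<le> \<epsilon>"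
proof -
  define \<epsilon>' where "\<epsilon>' i = \<epsilon> / 2 * (1/2) ^ i" for i :: nat
  have \<epsilon>'_pos: "0 < \<epsilon>' i" for i using \<epsilon> by (simp add: \<epsilon>'_def)
  have "\<exists>\<rho>. 0 < \<rho> \<and> (\<forall>y \<eta>. y \<in> V \<longrightarrow> nr y < \<rho> \<longrightarrow> 0 < \<eta> \<longrightarrow> (\<exists>g\<in>small_sums (\<epsilon>' i). nr (y - g) < \<eta>))" for i
    using closure_small_sums_neighbourhood[OF \<epsilon>'_pos[of i]] by metis
  then obtain \<rho> where \<rho>: "\<And>i. 0 < \<rho> i"
      "\<And>i y \<eta>. \<lbrakk>y \<in> V; nr y < \<rho> i; 0 < \<eta>\<rbrakk> \<Longrightarrow> \<exists>g\<in>small_sums (\<epsilon>' i). nr (y - g) < \<eta>"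
    by metis
  define \<sigma> where "\<sigma> i = min (\<rho> i) ((1/2) ^ i)" for i
  have \<sigma>_pos: "0 < \<sigma> i" for i using \<rho>(1) by (simp add: \<sigma>_def)
  have "nr (S n y) \<le> \<epsilon>" if y: "y \<in> V" "nr y < \<sigma> 0" for y n
  proof -
    have step: "\<exists>v'. v - v' \<in> small_sums (\<epsilon>' i) \<and> v' \<in> V \<and> nr v' < \<sigma> (Suc i)"
      if "v \<in> V \<and> nr v < \<sigma> i" for v i
    proof -
      from that obtain g where "g \<in> small_sums (\<epsilon>' i)" "nr (v - g) < \<sigma> (Suc i)"
        using \<rho>(2)[of v i "\<sigma> (Suc i)"] \<sigma>_pos by (auto simp: \<sigma>_def)
      then show ?thesis
        using that by (intro exI[of _ "v - g"]) (auto simp: small_sums_def)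
    qed
    \<comment> \<open>The remainders \<open>r i\<close> after subtracting the first \<open>i\<close> approximations.\<close>
    have "\<exists>f. \<forall>i. (f i \<in> V \<and> nr (f i) < \<sigma> i \<and> (i = 0 \<longrightarrow> f i = y)) \<and> f i - f (Suc i) \<in> small_sums (\<epsilon>' i)"
      by (rule dependent_nat_choice) (use y step in \<open>auto 4 4\<close>)
    then obtain r where r: "\<And>i. r i \<in> V" "\<And>i. nr (r i) < \<sigma> i" "r 0 = y"
        "\<And>i. r i - r (Suc i) \<in> small_sums (\<epsilon>' i)"
      by blast
    define z where "z k = y - r k" for k
    define g where "g i = r i - r (Suc i)" for i
    have z_eq: "z k = (\<Sum>i<k. g i)" for k
    proof (induction k)
      case (Suc k)
      have "z (Suc k) = z k + g k" by (simp add: z_def g_def)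
      then show ?case using Suc by simp
    qed (simp add: z_def r(3))
    have gV: "g i \<in> V" and Sg: "nr (S n (g i)) \<le> \<epsilon> / 2 * (1/2) ^ i" for i n
      using r(4)[of i] by (auto simp: small_sums_def g_def \<epsilon>'_def)
    have zV: "z k \<in> V" for k using r y by (simp add: z_def)
    have "\<exists>w. w \<in> V \<and> (\<forall>l. nr ((\<Sum>i<l. S n (g i)) - w) \<le> 2 * (\<epsilon> / 2) * (1/2) ^ l)" for n
      using geometric_series_converges[of "\<lambda>i. S n (g i)", OF _ Sg] by (metis S_in)
    then obtain w where wV: "\<And>n. w n \<in> V"
        and w': "\<And>n l. nr ((\<Sum>i<l. S n (g i)) - w n) \<le> 2 * (\<epsilon> / 2) * (1/2) ^ l"
      by metis
    have w: "nr (S n (z l) - w n) \<le> \<epsilon> * (1/2) ^ l" for n l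
      using w'[of n l] gV by (simp add: z_eq S_sum)
    have pow0: "(\<lambda>l. C * (1/2::real) ^ l) \<longlonglongrightarrow> 0" for C
      by (intro tendsto_mult_right_zero LIMSEQ_power_zero) simp
    \<comment> \<open>Here the line spanned by \<open>e n\<close> has to be closed.\<close>
    have "\<exists>b. w (Suc n) - w n = scale b (e n)" for n
    proof -
      have "scale (coef (z k) n) (e n) - (w (Suc n) - w n)
          = (S (Suc n) (z k) - w (Suc n)) - (S n (z k) - w n)" for k
        by (simp add: S_Suc_diff[symmetric])
      then have "nr (scale (coef (z k) n) (e n) - (w (Suc n) - w n))
          \<le> nr (S (Suc n) (z k) - w (Suc n)) + nr (S n (z k) - w n)" for k
        using nr_diff[of "S (Suc n) (z k) - w (Suc n)" "S n (z k) - w n"] wV by (simp only:) auto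
      also have "\<dots> k \<le> (2 * \<epsilon>) * (1/2) ^ k" for k
        using w[of "Suc n" k] w[of n k] by simp
      finally have "(\<lambda>k. nr (scale (coef (z k) n) (e n) - (w (Suc n) - w n))) \<longlonglongrightarrow> 0"
        by (rule nr_squeeze) (rule pow0)
      then show ?thesis
        using line_closed[OF e_in e_nonzero, of "w (Suc n) - w n"] wV V_closed(3) by metis
    qed
    then obtain b where b: "\<And>n. w (Suc n) - w n = scale (b n) (e n)"
      by metis
    have "(\<lambda>l. nr (0 - w 0)) \<longlonglongrightarrow> 0"
      using w[of 0] by (intro nr_squeeze[OF _ pow0[of \<epsilon>]]) (simp add: S_def)
    then have "nr (w 0) = 0"
      using wV by (simp add: LIMSEQ_const_iff nr_minus)
    then have w0: "w 0 = 0" using nr_eq_0_iff[OF wV] by simp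
    have w_eq: "w n = (\<Sum>j<n. scale (b j) (e j))" for n
    proof (induction n)
      case (Suc n)
      then show ?case using b[of n] by (simp add: algebra_simps)
    qed (simp add: w0)
    have "(\<lambda>n. nr (w n - y)) \<longlonglongrightarrow> 0"
      unfolding tendsto_iff
    proof (intro allI impI)
      fix \<eta> :: real assume \<eta>: "0 < \<eta>"
      obtain l where l: "(\<epsilon> + 1) * (1/2) ^ l < \<eta> / 2"
        using order_tendstoD(2)[OF pow0, of "\<eta> / 2"] \<eta> unfolding eventually_sequentially by auto
      have "nr (w n - y) < \<eta>" if "nr (S n (z l) - z l) < \<eta> / 2" for n
      proof -
        have "nr (w n - y) \<le> nr (w n - S n (z l)) + nr (S n (z l) - y)"
          using nr_add[of "w n - S n (z l)" "S n (z l) - y"] wV y by simp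
        also have "nr (S n (z l) - y) \<le> nr (S n (z l) - z l) + nr (z l - y)"
          using nr_add[of "S n (z l) - z l" "z l - y"] zV y by simp
        also have "nr (w n - S n (z l)) \<le> \<epsilon> * (1/2) ^ l"
          using w[of n l] wV by (simp add: nr_minus_commute[of "w n"])
        also have "nr (z l - y) \<le> (1/2) ^ l"
          using r(2)[of l] r(1) by (simp add: z_def nr_minus \<sigma>_def)
        finally show ?thesis using l that by (simp add: algebra_simps)
      qed
      then show "\<forall>\<^sub>F n in sequentially. dist (nr (w n - y)) 0 < \<eta>"
        using order_tendstoD(2)[OF S_converges[OF zV], of "\<eta> / 2" l] \<eta>
        by (auto elim: eventually_mono)
    qed
    then have "coef y = b"
      using y by (intro coef_eqI) (simp_all add: w_eq)
    then have "S n y = w n" by (simp add: S_def w_eq)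
    moreover have "nr (0 - w n) \<le> \<epsilon>"
      using w[of n 0] r(3) by (simp add: z_def)
    ultimately show ?thesis using wV by (simp add: nr_minus)
  qed
  then show thesis using \<sigma>_pos that by blast
qed

text \<open>
  In particular the coordinate projections, also after multiplication by scalars of norm at most
  \<open>1\<close>, are equicontinuous.
\<close>

lemma projections_equicontinuous:
  assumes \<epsilon>: "0 < \<epsilon>"
  obtains \<delta> where "0 < \<delta>"
    "\<And>n x c. \<lbrakk>x \<in> V; nr x < \<delta>; norm c \<le> 1\<rbrakk> \<Longrightarrow> nr (scale (c * coef x n) (e n)) < \<epsilon>"
proof -
  obtain \<epsilon>' where \<epsilon>': "0 < \<epsilon>'" "\<And>(c::'k) x. \<lbrakk>norm c \<le> 1; x \<in> V; nr x < \<epsilon>'\<rbrakk> \<Longrightarrow> nr (scale c x) < \<epsilon>"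
    using scale_bounded_small[OF \<epsilon>, where K = 1] by blast
  then obtain \<delta> where \<delta>: "0 < \<delta>" "\<And>n x. \<lbrakk>x \<in> V; nr x < \<delta>\<rbrakk> \<Longrightarrow> nr (S n x) \<le> \<epsilon>' / 3"
    using S_equicontinuous[of "\<epsilon>' / 3"] by auto
  show thesis
  proof (rule that[OF \<delta>(1)])
    fix n x and c :: 'k assume *: "x \<in> V" "nr x < \<delta>" "norm c \<le> 1"
    have "nr (scale (coef x n) (e n)) \<le> nr (S (Suc n) x) + nr (S n x)"
      unfolding S_Suc_diff[symmetric] by (intro nr_diff) auto
    also have "\<dots> < \<epsilon>'" using \<delta>(2)[OF *(1,2), of n] \<delta>(2)[OF *(1,2), of "Suc n"] \<epsilon>'(1) by simp
    finally have "nr (scale c (scale (coef x n) (e n))) < \<epsilon>"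
      using *(3) by (intro \<epsilon>'(2)) auto
    then show "nr (scale (c * coef x n) (e n)) < \<epsilon>" by simp
  qed
qed

end


section \<open>Steps, coordinates and continuous seminorms of the inductive limit\<close>

locale lf_shift = lf_space scale E X T
  for scale :: "'k::{real_normed_field,euclidean_space} \<Rightarrow> 'a::ab_group_add \<Rightarrow> 'a" and E X T +
  fixes e :: "nat \<Rightarrow> 'a" and B :: "'a \<Rightarrow> 'a"
  assumes basis: "stepwise_schauder_basis e"
    and shift: "associated_backward_shift e B"
begin

text \<open>A choice of a complete invariant metric for each step.\<close>

definition dist_on :: "nat \<Rightarrow> 'a \<Rightarrow> 'a \<Rightarrow> real" where
  "dist_on m = (SOME d. Metric_space (E m) d \<and>
     (\<forall>x\<in>E m. \<forall>y\<in>E m. \<forall>z\<in>E m. d (x + z) (y + z) = d x y) \<and>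
     Metric_space.mcomplete (E m) d \<and> X m = Metric_space.mtopology (E m) d)"

lemma dist_on:
  "Metric_space (E m) (dist_on m)"
  "\<lbrakk>x \<in> E m; y \<in> E m; z \<in> E m\<rbrakk> \<Longrightarrow> dist_on m (x + z) (y + z) = dist_on m x y"
  "Metric_space.mcomplete (E m) (dist_on m)"
  "X m = Metric_space.mtopology (E m) (dist_on m)"
proof -
  have "frechet_space (E m) (X m)"
    using spectrum by (simp add: inductive_spectrum_def)
  then have "\<exists>d. Metric_space (E m) d \<and>
     (\<forall>x\<in>E m. \<forall>y\<in>E m. \<forall>z\<in>E m. d (x + z) (y + z) = d x y) \<and>
     Metric_space.mcomplete (E m) d \<and> X m = Metric_space.mtopology (E m) d"
    by (simp add: frechet_space_def)
  from someI_ex[OF this] show "Metric_space (E m) (dist_on m)"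
    "\<lbrakk>x \<in> E m; y \<in> E m; z \<in> E m\<rbrakk> \<Longrightarrow> dist_on m (x + z) (y + z) = dist_on m x y"
    "Metric_space.mcomplete (E m) (dist_on m)"
    "X m = Metric_space.mtopology (E m) (dist_on m)"
    unfolding dist_on_def[symmetric] by blast+
qed

sublocale step: step_with_basis scale "E m" "dist_on m" e for m
proof (intro step_with_basis.intro complete_metric_tvs.intro complete_metric_tvs_axioms.intro
    step_with_basis_axioms.intro)
  have "locally_convex_topology (E m) (X m)"
    using spectrum by (simp add: inductive_spectrum_def frechet_space_def)
  then show "subspace (E m)"
    "continuous_map (prod_topology euclidean (Metric_space.mtopology (E m) (dist_on m)))
      (Metric_space.mtopology (E m) (dist_on m)) (\<lambda>(c, x). scale c x)"
    unfolding dist_on(4)[symmetric] by (simp_all add: locally_convex_topology_def)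
  show "schauder_basis (E m) (Metric_space.mtopology (E m) (dist_on m)) e"
    using basis unfolding stepwise_schauder_basis_def dist_on(4)[symmetric] by blast
  show "rc_vector_space scale" by unfold_locales
qed (rule dist_on; assumption?)+

abbreviation nrm :: "nat \<Rightarrow> 'a \<Rightarrow> real" where
  "nrm \<equiv> step.nr"

lemma X_eq: "X m = step.mtopology m"
  by (rule dist_on(4))

lemma E_covers: obtains m where "x \<in> E m"
proof -
  have "x \<in> (\<Union>m. E m)" by (simp add: union)
  then show thesis using that by (elim UN_E)
qed

lemma E_mono: "m \<le> m' \<Longrightarrow> E m \<subseteq> E m'"
  by (rule lift_Suc_mono_le[of E]) (use spectrum in \<open>simp_all add: inductive_spectrum_def\<close>)

lemma E_common: obtains m where "x \<in> E m" "y \<in> E m"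
proof -
  obtain i j where "x \<in> E i" "y \<in> E j" using E_covers by metis
  then show thesis
    using E_mono[of i "max i j"] E_mono[of j "max i j"] by (intro that[of "max i j"]) auto
qed

lemma inclusion_continuous: "m \<le> m' \<Longrightarrow> continuous_map (X m) (X m') (\<lambda>x. x)"
proof (induction rule: dec_induct)
  case (step k)
  have "continuous_map (X k) (X (Suc k)) (\<lambda>x. x)"
    using spectrum by (simp add: inductive_spectrum_def)
  from continuous_map_compose[OF step.IH this] show ?case by (simp add: o_def)
qed simp

lemma limitin_step: "m \<le> m' \<Longrightarrow> limitin (X m) f l F \<Longrightarrow> limitin (X m') f l F"
  using continuous_map_limit[OF inclusion_continuous] by (fastforce simp: o_def)

lemma limitin_limit: "limitin (X m) f l F \<Longrightarrow> limitin T f l F"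
  using limit_topology continuous_map_limit[of "X m" T "\<lambda>x. x"]
  by (simp add: inductive_limit_topology_def o_def)

lemma topspace_T: "topspace T = UNIV"
  using limit_topology union by (auto simp: inductive_limit_topology_def locally_convex_topology_def)

lemma nrm_mono:
  assumes "m \<le> m'" "0 < \<epsilon>"
  obtains \<delta> where "0 < \<delta>" "\<And>x. \<lbrakk>x \<in> E m; nrm m x < \<delta>\<rbrakk> \<Longrightarrow> nrm m' x < \<epsilon>"
proof -
  define W where "W = {x \<in> topspace (X m). x \<in> step.mball m' 0 \<epsilon>}"
  have "openin (X m) W"
    unfolding W_def using inclusion_continuous[OF assms(1)]
    by (rule openin_continuous_map_preimage) (simp add: X_eq)
  then have "\<exists>\<delta>>0. step.mball m x \<delta> \<subseteq> W" if "x \<in> W" for x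
    using that by (simp add: X_eq step.openin_mtopology)
  moreover have "0 \<in> W"
    using assms(2) by (simp add: X_eq W_def)
  ultimately obtain \<delta> where \<delta>: "0 < \<delta>" "step.mball m 0 \<delta> \<subseteq> W"
    by blast
  show thesis
  proof (rule that[OF \<delta>(1)])
    fix x assume "x \<in> E m" "nrm m x < \<delta>"
    then have "x \<in> step.mball m 0 \<delta>" by (simp add: step.nr_def step.commute)
    then have "x \<in> step.mball m' 0 \<epsilon>" using \<delta>(2) by (auto simp: W_def)
    then show "nrm m' x < \<epsilon>" by (simp add: step.nr_def step.commute)
  qed
qed

text \<open>
  The coordinates of a vector of the inductive limit. By uniqueness of the expansion they do not
  depend on the step in which the vector is expanded, see \<open>coef_eq_cf\<close>.
\<close>

definition cf :: "'a \<Rightarrow> nat \<Rightarrow> 'k" where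
  "cf x = step.coef (LEAST m. x \<in> E m) x"

lemma coef_eq_cf: "x \<in> E m \<Longrightarrow> step.coef m x = cf x"
proof -
  assume x: "x \<in> E m"
  define l where "l = (LEAST m. x \<in> E m)"
  have l: "x \<in> E l" "l \<le> m" unfolding l_def using x by (auto intro: LeastI Least_le)
  have "limitin (X l) (\<lambda>n. \<Sum>j<n. scale (cf x j) (e j)) x sequentially"
    using step.expansion[OF l(1)] by (simp add: X_eq step.S_def cf_def l_def)
  then have "limitin (X m) (\<lambda>n. \<Sum>j<n. scale (cf x j) (e j)) x sequentially"
    using l by (intro limitin_step[of l m])
  then show ?thesis by (intro step.coef_eqI_limitin) (simp add: X_eq)
qed

lemma S_eq: "x \<in> E m \<Longrightarrow> step.S m n x = (\<Sum>j<n. scale (cf x j) (e j))"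
  by (simp add: step.S_def coef_eq_cf)

lemma cf_diff: "cf (x - y) j = cf x j - cf y j"
proof -
  obtain m where m: "x \<in> E m" "y \<in> E m" by (rule E_common)
  then show ?thesis using step.coef_diff[OF m] by (simp add: coef_eq_cf)
qed

lemma cf_scale: "cf (scale c x) j = c * cf x j"
proof -
  obtain m where m: "x \<in> E m" by (rule E_covers)
  then show ?thesis using step.coef_scale[OF m] by (simp add: coef_eq_cf)
qed

lemma cf_0 [simp]: "cf 0 j = 0"
  using cf_diff[of 0 0] by simp

lemma cf_add: "cf (x + y) j = cf x j + cf y j"
  using cf_diff[of x "- y"] cf_diff[of 0 y] by simp

lemma cf_sum: "cf (sum f I) j = (\<Sum>i\<in>I. cf (f i) j)"
  by (induction I rule: infinite_finite_induct) (simp_all add: cf_add)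

lemma cf_combination: "cf (\<Sum>j<n. scale (b j) (e j)) = (\<lambda>j. if j < n then b j else 0)"
  using coef_eq_cf[OF step.combination_in] step.coef_combination by metis

lemma cf_e: "cf (e k) j = (if j = k then 1 else 0)"
proof -
  have eq: "(\<Sum>j<Suc k. scale (if j = k then 1 else 0) (e j)) = e k"
    by (simp add: sum.neutral)
  show ?thesis
    using fun_cong[OF cf_combination[where n = "Suc k" and b = "\<lambda>j. if j = k then 1 else 0"], of j]
    unfolding eq by (simp split: if_splits)
qed

text \<open>
  A seminorm that is bounded on a neighbourhood of \<open>0\<close> of each step is continuous on the inductive
  limit: the topology defined by the seminorm is one of the locally convex topologies of which the
  inductive limit topology is the finest.
\<close>

lemma seminorm_open:
  fixes p :: "'a \<Rightarrow> real"
  assumes p_add: "\<And>x y. p (x + y) \<le> p x + p y"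
    and p_scale: "\<And>c x. p (scale c x) \<le> norm c * p x"
    and bounded: "\<And>m. \<exists>\<delta>>0. \<forall>x\<in>E m. nrm m x < \<delta> \<longrightarrow> p x \<le> 1"
  shows "openin T {x. p (x - a) < r}"
proof -
  have p0: "p 0 = 0" using p_add[of 0 0] p_scale[of 0 0] by simp
  have p_minus: "p (- x) \<le> p x" for x using p_scale[of "-1" x] by simp
  have p_nonneg: "0 \<le> p x" for x using p_add[of x "- x"] p_minus[of x] p0 by simp
  have p_diff: "p (x - z) \<le> p (x - y) + p (y - z)" for x y z using p_add[of "x - y" "y - z"] by simp
  define Op where "Op U \<longleftrightarrow> (\<forall>x\<in>U. \<exists>r>0. \<forall>y. p (y - x) < r \<longrightarrow> y \<in> U)" for U
  define P where "P = topology Op"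
  have "istopology Op"
    unfolding istopology_def
  proof (intro conjI allI impI)
    fix U W assume UW: "Op U" "Op W"
    show "Op (U \<inter> W)"
      unfolding Op_def
    proof
      fix x assume "x \<in> U \<inter> W"
      then obtain r r' where "r > 0" "\<forall>y. p (y - x) < r \<longrightarrow> y \<in> U" "r' > 0" "\<forall>y. p (y - x) < r' \<longrightarrow> y \<in> W"
        using UW unfolding Op_def by (metis IntE)
      then show "\<exists>r>0. \<forall>y. p (y - x) < r \<longrightarrow> y \<in> U \<inter> W"
        by (intro exI[of _ "min r r'"]) simp
    qed
  next
    fix K assume "\<forall>U\<in>K. Op U"
    then show "Op (\<Union>K)" unfolding Op_def by (meson UnionE UnionI)
  qed
  then have open_P: "openin P U \<longleftrightarrow> Op U" for U
    unfolding P_def by (simp add: topology_inverse')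
  have ball: "openin P {y. p (y - x) < r}" for x r
    unfolding open_P Op_def
  proof
    fix y assume "y \<in> {y. p (y - x) < r}"
    moreover have "z \<in> {y. p (y - x) < r}" if "p (z - y) < r - p (y - x)" for z
      using p_diff[of z x y] that by simp
    ultimately show "\<exists>r'>0. \<forall>z. p (z - y) < r' \<longrightarrow> z \<in> {y. p (y - x) < r}"
      by (intro exI[of _ "r - p (y - x)"]) simp
  qed
  have "openin P UNIV" unfolding open_P Op_def by (simp add: gt_ex)
  then have top_P: "topspace P = UNIV" by (metis openin_subset top.extremum_uniqueI)
  have "locally_convex_topology UNIV P"
    unfolding locally_convex_topology_def
  proof (intro conjI allI impI)
    show "continuous_map (prod_topology P P) P (\<lambda>(x, y). x + y)"
      unfolding continuous_map_def
    proof (intro conjI allI impI)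
      fix U assume U: "openin P U"
      show "openin (prod_topology P P) {z \<in> topspace (prod_topology P P). (case z of (x, y) \<Rightarrow> x + y) \<in> U}"
        unfolding openin_prod_topology_alt
      proof (intro allI impI)
        fix x y assume "(x, y) \<in> {z \<in> topspace (prod_topology P P). (case z of (x, y) \<Rightarrow> x + y) \<in> U}"
        then obtain r where r: "r > 0" "\<And>z. p (z - (x + y)) < r \<Longrightarrow> z \<in> U"
          using U unfolding open_P Op_def by auto
        have "x' + y' \<in> U" if "p (x' - x) < r / 2" "p (y' - y) < r / 2" for x' y'
          using p_add[of "x' - x" "y' - y"] that by (intro r(2)) (simp add: algebra_simps)
        then show "\<exists>A C. openin P A \<and> openin P C \<and> x \<in> A \<and> y \<in> C \<and>
            A \<times> C \<subseteq> {z \<in> topspace (prod_topology P P). (case z of (x, y) \<Rightarrow> x + y) \<in> U}"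
          using r(1) ball[of x "r / 2"] ball[of y "r / 2"]
          by - (rule exI[of _ "{x'. p (x' - x) < r / 2}"], rule exI[of _ "{y'. p (y' - y) < r / 2}"],
              auto simp: p0 top_P)
      qed
    qed (simp add: top_P)
  next
    show "continuous_map (prod_topology euclidean P) P (\<lambda>(c, x). scale c x)"
      unfolding continuous_map_def
    proof (intro conjI allI impI)
      fix U assume U: "openin P U"
      show "openin (prod_topology euclidean P) {z \<in> topspace (prod_topology euclidean P). (case z of (c, x) \<Rightarrow> scale c x) \<in> U}"
        unfolding openin_prod_topology_alt
      proof (intro allI impI)
        fix c :: 'k and x assume "(c, x) \<in> {z \<in> topspace (prod_topology euclidean P). (case z of (c, x) \<Rightarrow> scale c x) \<in> U}"
        then obtain r where r: "r > 0" "\<And>z. p (z - scale c x) < r \<Longrightarrow> z \<in> U"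
          using U unfolding open_P Op_def by auto
        define k where "k = norm c + 1"
        define q where "q = p x + 1"
        have k: "k > 0" and q: "q > 0" "p x \<le> q"
          using p_nonneg[of x] by (simp_all add: k_def q_def add_nonneg_pos)
        define \<eta> where "\<eta> = min 1 (r / (2 * q))"
        define \<theta> where "\<theta> = r / (2 * k)"
        have \<theta>: "\<theta> > 0" using r(1) k by (simp add: \<theta>_def)
        have \<eta>: "\<eta> > 0" using r(1) q by (simp add: \<eta>_def)
        have "scale c' x' \<in> U" if "norm (c' - c) < \<eta>" "p (x' - x) < \<theta>" for c' x'
        proof (rule r(2))
          have c': "norm c' \<le> k"
            using that(1) norm_triangle_sub[of c' c] by (simp add: \<eta>_def k_def)
          have "scale c' x' - scale c x = scale c' (x' - x) + scale (c' - c) x"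
            by (simp add: scale_right_diff_distrib scale_left_diff_distrib)
          then have "p (scale c' x' - scale c x) \<le> norm c' * p (x' - x) + norm (c' - c) * p x"
            using p_add[of "scale c' (x' - x)" "scale (c' - c) x"] p_scale[of c' "x' - x"]
              p_scale[of "c' - c" x] by simp
          also have "norm c' * p (x' - x) \<le> k * p (x' - x)"
            using c' p_nonneg by (intro mult_right_mono)
          also have "k * p (x' - x) < k * \<theta>"
            using that(2) k by (intro mult_strict_left_mono) auto
          also have "k * \<theta> = r / 2"
            using k by (simp add: \<theta>_def)
          also have "norm (c' - c) * p x \<le> r / (2 * q) * q"
            using that(1) p_nonneg[of x] q r(1) by (intro mult_mono) (auto simp: \<eta>_def)
          also have "\<dots> = r / 2"
            using q by simp
          finally show "p (scale c' x' - scale c x) < r" by simp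
        qed
        then show "\<exists>A C. openin euclidean A \<and> openin P C \<and> c \<in> A \<and> x \<in> C \<and>
            A \<times> C \<subseteq> {z \<in> topspace (prod_topology euclidean P). (case z of (c, x) \<Rightarrow> scale c x) \<in> U}"
          using \<eta> \<theta>
          by - (rule exI[of _ "ball c \<eta>"], rule exI[of _ "{x'. p (x' - x) < \<theta>}"],
              auto simp: ball p0 top_P dist_norm norm_minus_commute)
      qed
    qed (simp add: top_P)
  next
    fix U assume "openin P U \<and> 0 \<in> U"
    then obtain r where r: "r > 0" "\<And>y. p y < r \<Longrightarrow> y \<in> U"
      unfolding open_P Op_def by auto
    have "convex_set {y. p y < r}"
      unfolding convex_set_def
    proof (intro ballI allI impI)
      fix x y and u v :: real
      assume *: "x \<in> {y. p y < r}" "y \<in> {y. p y < r}" "0 \<le> u" "0 \<le> v" "u + v = 1"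
      have "p (scale (of_real u) x + scale (of_real v) y) \<le> u * p x + v * p y"
        using p_add[of "scale (of_real u) x" "scale (of_real v) y"] p_scale[of "of_real u" x]
          p_scale[of "of_real v" y] *(3,4) by simp
      also have "\<dots> < r" using * by (intro convex_bound_lt) auto
      finally show "scale (of_real u) x + scale (of_real v) y \<in> {y. p y < r}" by simp
    qed
    then show "\<exists>C. openin P C \<and> 0 \<in> C \<and> C \<subseteq> U \<and> convex_set C"
      using ball[of 0 r] r p0 by (intro exI[of _ "{y. p y < r}"]) auto
  qed (simp_all add: top_P)
  moreover have "continuous_map (X m) P (\<lambda>x. x)" for m
    unfolding continuous_map_def
  proof (intro conjI allI impI)
    fix U assume U: "openin P U"
    have "\<exists>\<rho>>0. step.mball m x \<rho> \<subseteq> {x \<in> E m. x \<in> U}" if x: "x \<in> E m" "x \<in> U" for x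
    proof -
      obtain r where r: "r > 0" "\<And>y. p (y - x) < r \<Longrightarrow> y \<in> U"
        using U x(2) unfolding open_P Op_def by blast
      obtain \<delta> where \<delta>: "\<delta> > 0" "\<And>x. x \<in> E m \<Longrightarrow> nrm m x < \<delta> \<Longrightarrow> p x \<le> 1"
        using bounded[of m] by blast
      define t where "t = (of_real (r / 2) :: 'k)"
      have t: "t \<noteq> 0" "norm t = r / 2" using r(1) by (simp_all add: t_def del: of_real_divide)
      obtain \<rho> where \<rho>: "\<rho> > 0" "\<And>(c::'k) z. \<lbrakk>norm c \<le> norm (inverse t); z \<in> E m; nrm m z < \<rho>\<rbrakk> \<Longrightarrow> nrm m (scale c z) < \<delta>"
        using step.scale_bounded_small[OF \<delta>(1), where m = m and K = "norm (inverse t)"] by blast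
      have "y \<in> U" if y: "y \<in> E m" "nrm m (y - x) < \<rho>" for y
      proof (rule r(2))
        have "nrm m (scale (inverse t) (y - x)) < \<delta>"
          using y x by (intro \<rho>(2)) auto
        then have "p (scale (inverse t) (y - x)) \<le> 1"
          using y(1) x by (intro \<delta>(2)) auto
        moreover have "p (y - x) \<le> norm t * p (scale (inverse t) (y - x))"
          using p_scale[of t "scale (inverse t) (y - x)"] t(1) by simp
        ultimately have "p (y - x) \<le> r / 2 * 1"
          unfolding t(2) using r(1) by (meson half_gt_zero less_imp_le mult_left_mono order_trans)
        then show "p (y - x) < r" using r(1) by simp
      qed
      then show ?thesis
        using \<rho>(1) x by (intro exI[of _ \<rho>]) (auto simp: step.d_eq_nr step.nr_minus_commute[of x])
    qed
    then show "openin (X m) {x \<in> topspace (X m). x \<in> U}"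
      by (simp add: X_eq step.openin_mtopology)
  qed (simp add: top_P)
  moreover have "\<forall>S. locally_convex_topology UNIV S \<and> (\<forall>m. continuous_map (X m) S (\<lambda>x. x)) \<longrightarrow>
      (\<forall>U. openin S U \<longrightarrow> openin T U)"
    using limit_topology by (simp add: inductive_limit_topology_def union)
  ultimately show ?thesis
    using ball[of a r] by blast
qed

text \<open>
  If the basis vectors with index in \<open>J\<close> stay away from \<open>0\<close> in each step, the supremum of the
  coordinates with index in \<open>J\<close> is a continuous seminorm. For, if a vector \<open>x\<close> is so close to
  \<open>0\<close> in the step \<open>m\<close> that the multiples of \<open>x\<^sub>n e\<^sub>n\<close> by scalars of norm at most \<open>1\<close> are
  \<open>\<epsilon>\<^sub>m\<close>-small, then \<open>|x\<^sub>n| \<le> 1\<close>, as otherwise \<open>e\<^sub>n\<close> would be one of these multiples.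
\<close>

lemma coordinates_seminorm:
  fixes J :: "nat set" and \<epsilon> :: "nat \<Rightarrow> real"
  defines "p \<equiv> \<lambda>x. SUP n\<in>J. norm (cf x n)"
  assumes J: "J \<noteq> {}" and \<epsilon>: "\<And>m. 0 < \<epsilon> m" and large: "\<And>m n. n \<in> J \<Longrightarrow> \<epsilon> m \<le> nrm m (e n)"
  shows coordinate_le_seminorm: "n \<in> J \<Longrightarrow> norm (cf x n) \<le> p x"
    and coordinates_seminorm_open: "openin T {x. p (x - a) < r}"
proof -
  have local_bound: "\<exists>\<delta>>0. \<forall>x\<in>E m. nrm m x < \<delta> \<longrightarrow> (\<forall>n\<in>J. norm (cf x n) \<le> 1)" for m
  proof -
    obtain \<delta> where \<delta>: "0 < \<delta>"
      "\<And>n x c. \<lbrakk>x \<in> E m; nrm m x < \<delta>; norm c \<le> 1\<rbrakk> \<Longrightarrow> nrm m (scale (c * step.coef m x n) (e n)) < \<epsilon> m"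
      using step.projections_equicontinuous[OF \<epsilon>[of m], where m = m] by blast
    have "norm (cf x n) \<le> 1" if x: "x \<in> E m" "nrm m x < \<delta>" and n: "n \<in> J" for x n
    proof (rule ccontr)
      assume big: "\<not> norm (cf x n) \<le> 1"
      then have "cf x n \<noteq> 0" by auto
      moreover have "norm (inverse (cf x n)) \<le> 1"
        unfolding norm_inverse using big by (simp add: inverse_le_1_iff)
      ultimately have "nrm m (e n) < \<epsilon> m"
        using \<delta>(2)[OF x, of "inverse (cf x n)" n] x by (simp add: coef_eq_cf)
      then show False using large[OF n, of m] by simp
    qed
    then show ?thesis using \<delta>(1) by blast
  qed
  have bdd: "bdd_above ((\<lambda>n. norm (cf x n)) ` J)" for x
  proof -
    obtain m where x: "x \<in> E m" by (rule E_covers)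
    obtain \<delta> where \<delta>: "0 < \<delta>" "\<And>x n. \<lbrakk>x \<in> E m; nrm m x < \<delta>; n \<in> J\<rbrakk> \<Longrightarrow> norm (cf x n) \<le> 1"
      using local_bound[of m] by blast
    obtain t :: real where t: "0 < t" "nrm m (scale (of_real t) x) < \<delta>"
      by (rule step.scale_absorb[OF x \<delta>(1)])
    have "norm (cf x n) \<le> 1 / t" if "n \<in> J" for n
      using \<delta>(2)[OF _ t(2) that] x t(1) by (simp add: cf_scale norm_mult field_simps)
    then show ?thesis by (intro bdd_aboveI2)
  qed
  show upper: "norm (cf x n) \<le> p x" if "n \<in> J" for x n
    unfolding p_def using that bdd by (rule cSUP_upper)
  have least: "p x \<le> C" if "\<And>n. n \<in> J \<Longrightarrow> norm (cf x n) \<le> C" for x C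
    unfolding p_def using J that by (rule cSUP_least)
  show "openin T {x. p (x - a) < r}"
  proof (rule seminorm_open)
    fix x y
    show "p (x + y) \<le> p x + p y"
    proof (rule least)
      fix n assume n: "n \<in> J"
      have "norm (cf (x + y) n) \<le> norm (cf x n) + norm (cf y n)"
        by (simp add: cf_add norm_triangle_ineq)
      also have "\<dots> \<le> p x + p y" by (intro add_mono upper n)
      finally show "norm (cf (x + y) n) \<le> p x + p y" .
    qed
  next
    fix c x
    show "p (scale c x) \<le> norm c * p x"
      by (rule least) (simp add: cf_scale norm_mult upper mult_left_mono)
  next
    fix m
    show "\<exists>\<delta>>0. \<forall>x\<in>E m. nrm m x < \<delta> \<longrightarrow> p x \<le> 1"
      using local_bound[of m] least by meson
  qed
qed

lemma nrm_e_pos: "0 < nrm m (e n)"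
  by (rule step.nr_pos[OF step.e_in step.e_nonzero])

lemma coordinate_open: "openin T {x. norm (cf (x - a) n) < r}"
  using coordinates_seminorm_open[of "{n}" "\<lambda>m. nrm m (e n)" a r] nrm_e_pos by simp

lemma cf_tendsto:
  assumes "limitin T f l F"
  shows "((\<lambda>k. cf (f k) j) \<longlongrightarrow> cf l j) F"
  unfolding tendsto_iff
proof (intro allI impI)
  fix r :: real assume "0 < r"
  then have "l \<in> {x. norm (cf (x - l) j) < r}" by simp
  then have "\<forall>\<^sub>F k in F. f k \<in> {x. norm (cf (x - l) j) < r}"
    using assms coordinate_open[of l j r] unfolding limitin_def by blast
  then show "\<forall>\<^sub>F k in F. dist (cf (f k) j) (cf l j) < r"
    by (simp add: cf_diff dist_norm)
qed

section \<open>The shift: mixing and continuity between steps\<close>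

lemma B_linear: "module_hom scale scale B"
  using shift unfolding associated_backward_shift_def module_hom_iff_linear by blast

lemma B_0: "B 0 = 0" and B_add: "B (x + y) = B x + B y" and B_scale: "B (scale c x) = scale c (B x)"
  and B_e_0: "B (e 0) = 0" and B_e_Suc: "B (e (Suc j)) = e j"
  using module_hom.zero[OF B_linear] module_hom.add[OF B_linear] module_hom.scale[OF B_linear] shift
  by (simp_all add: associated_backward_shift_def)

lemma B_sum: "B (sum f I) = (\<Sum>i\<in>I. B (f i))"
  by (rule module_hom.sum[OF B_linear])

lemma limitin_B: "limitin T f l F \<Longrightarrow> limitin T (\<lambda>k. B (f k)) (B l) F"
  using shift continuous_map_limit[of T T B] by (simp add: associated_backward_shift_def o_def)

lemma cf_B: "cf (B x) j = cf x (Suc j)"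
proof -
  obtain m where x: "x \<in> E m" by (rule E_covers)
  have "limitin T (\<lambda>n. \<Sum>j<n. scale (cf x j) (e j)) x sequentially"
    using step.expansion[OF x] S_eq[OF x] by (intro limitin_limit[of m]) (simp add: X_eq)
  from cf_tendsto[OF limitin_B[OF this], of j] have "(\<lambda>n. cf (B (\<Sum>j<n. scale (cf x j) (e j))) j) \<longlonglongrightarrow> cf (B x) j" .
  moreover have "cf (B (\<Sum>j<n. scale (cf x j) (e j))) j = cf x (Suc j)" if n: "n \<ge> Suc (Suc j)" for n
  proof -
    obtain k where k: "n = Suc k" using n by (cases n) auto
    have "B (\<Sum>j<n. scale (cf x j) (e j)) = (\<Sum>j<k. scale (cf x (Suc j)) (e j))"
      unfolding k by (subst sum.lessThan_Suc_shift) (simp add: B_add B_sum B_scale B_e_0 B_e_Suc)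
    then show ?thesis using n by (simp add: cf_combination k)
  qed
  then have "\<forall>\<^sub>F n in sequentially. cf (B (\<Sum>j<n. scale (cf x j) (e j))) j = cf x (Suc j)"
    unfolding eventually_sequentially by blast
  then have "(\<lambda>n. cf (B (\<Sum>j<n. scale (cf x j) (e j))) j) \<longlonglongrightarrow> cf x (Suc j)"
    by (rule tendsto_eventually)
  ultimately show ?thesis by (rule LIMSEQ_unique)
qed

lemma cf_B_pow: "cf ((B ^^ n) x) j = cf x (j + n)"
  by (induction n arbitrary: j) (simp_all add: cf_B)

text \<open>
  This is the only use of mixing. It is a pointwise form of \<open>e\<^sub>n \<longlonglongrightarrow> 0\<close> in \<open>E\<close>; the sequence of the
  \<open>e\<^sub>n\<close> need not converge to \<open>0\<close> in any single step.
\<close>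

lemma mixing_imp_finite_large:
  assumes mixing: "mixing T B" and \<epsilon>: "\<And>m. 0 < \<epsilon> m"
  shows "finite {n. \<forall>m. \<epsilon> m \<le> nrm m (e n)}"
proof (rule ccontr)
  let ?J = "{n. \<forall>m. \<epsilon> m \<le> nrm m (e n)}"
  assume inf: "infinite ?J"
  then have ne: "?J \<noteq> {}" by (metis finite.emptyI)
  define p where "p x = (SUP n\<in>?J. norm (cf x n))" for x
  have large: "\<And>m n. n \<in> ?J \<Longrightarrow> \<epsilon> m \<le> nrm m (e n)" by simp
  have p: "norm (cf x n) \<le> p x" if "n \<in> ?J" for n x
    unfolding p_def by (rule coordinate_le_seminorm[OF ne \<epsilon> large that])
  have p_open: "openin T {x. p (x - a) < r}" for a r
    unfolding p_def by (rule coordinates_seminorm_open[OF ne \<epsilon> large])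
  let ?U = "{x. p (x - 0) < 1 / 2}" and ?W = "{x. norm (cf (x - e 0) 0) < 1 / 2}"
  have "p 0 = 0" unfolding p_def using ne by (simp add: cSUP_const)
  then have "0 \<in> ?U" "e 0 \<in> ?W" by simp_all
  then have "?U \<noteq> {}" "?W \<noteq> {}" by blast+
  then have "\<forall>\<^sub>F n in cofinite. (B ^^ n) ` ?U \<inter> ?W \<noteq> {}"
    using mixing p_open[of 0 "1/2"] coordinate_open[of "e 0" 0 "1/2"] unfolding mixing_def by blast
  then have "finite {n. (B ^^ n) ` ?U \<inter> ?W = {}}"
    by (simp add: eventually_cofinite)
  then have "infinite (?J - {n. (B ^^ n) ` ?U \<inter> ?W = {}})"
    using inf by (rule Diff_infinite_finite)
  from infinite_imp_nonempty[OF this] obtain n where "n \<in> ?J - {n. (B ^^ n) ` ?U \<inter> ?W = {}}"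
    unfolding ex_in_conv[symmetric] by (elim exE)
  then have n: "n \<in> ?J" "(B ^^ n) ` ?U \<inter> ?W \<noteq> {}" by simp_all
  then obtain x where x: "x \<in> ?U" "(B ^^ n) x \<in> ?W" by blast
  then have "norm (cf x n - 1) < 1 / 2" by (simp add: cf_diff cf_B_pow cf_e)
  moreover have "norm (cf x n) < 1 / 2" using x(1) p[OF n(1), of x] by simp
  moreover have "norm (1 :: 'k) \<le> norm (cf x n) + norm (cf x n - 1)"
    using norm_triangle_ineq4[of "cf x n" "cf x n - 1"] by simp
  ultimately show False by simp
qed

text \<open>
  Continuity of \<open>B\<close> between steps, restricted to the basis vectors. If no \<open>s\<close> works, then for each
  \<open>s\<close> there are infinitely many \<open>j\<close> with \<open>e\<^bsub>j+1\<^esub>\<close> tiny in the step \<open>r\<close> and \<open>e\<^sub>j\<close> not small in the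
  step \<open>s\<close>. A convergent sum \<open>x\<close> of such \<open>e\<^bsub>j+1\<^esub>\<close>, in which every \<open>s\<close> occurs infinitely often, is
  mapped into some step \<open>s\<close>, in which the terms of the expansion of \<open>B x\<close> do not tend to \<open>0\<close>.
\<close>

lemma shift_step_continuous:
  "\<exists>s. \<forall>\<epsilon>>0. \<exists>\<delta>>0. \<forall>j. nrm r (e (Suc j)) < \<delta> \<longrightarrow> nrm s (e j) < \<epsilon>"
proof (rule ccontr)
  assume "\<not> ?thesis"
  then have "\<exists>\<epsilon>>0. \<forall>\<delta>>0. \<exists>j. nrm r (e (Suc j)) < \<delta> \<and> \<epsilon> \<le> nrm s (e j)" for s
    by (meson not_le)
  then obtain \<epsilon> where \<epsilon>: "\<And>s. 0 < \<epsilon> s"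
      "\<And>s \<delta>. 0 < \<delta> \<Longrightarrow> \<exists>j. nrm r (e (Suc j)) < \<delta> \<and> \<epsilon> s \<le> nrm s (e j)"
    by metis
  have late: "\<exists>j>N. nrm r (e (Suc j)) < \<delta> \<and> \<epsilon> s \<le> nrm s (e j)" if "0 < \<delta>" for s \<delta> N
  proof -
    \<comment> \<open>Smaller than the finitely many values that would allow an index up to \<open>N\<close>.\<close>
    let ?\<delta> = "Min (insert \<delta> ((\<lambda>j. nrm r (e (Suc j))) ` {..N}))"
    have "0 < ?\<delta>" using that nrm_e_pos by simp
    then obtain j where j: "nrm r (e (Suc j)) < ?\<delta>" "\<epsilon> s \<le> nrm s (e j)"
      using \<epsilon>(2)[of ?\<delta> s] by blast
    then have "\<not> j \<le> N" by auto
    then show ?thesis using j by auto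
  qed
  \<comment> \<open>A sequence of steps that takes every value infinitely often.\<close>
  let ?s = "\<lambda>i. fst (prod_decode i)"
  let ?P = "\<lambda>i j. nrm r (e (Suc j)) < (1/2) ^ i \<and> \<epsilon> (?s i) \<le> nrm (?s i) (e j)"
  have "\<exists>f. \<forall>i. ?P i (f i) \<and> f i < f (Suc i)"
  proof (rule dependent_nat_choice)
    show "\<exists>j. ?P 0 j" using late[of "(1/2) ^ 0" 0 "?s 0"] by auto
    fix j i show "\<exists>j'. ?P (Suc i) j' \<and> j < j'" using late[of "(1/2) ^ Suc i" j "?s (Suc i)"] by auto
  qed
  then obtain f where f: "\<And>i. nrm r (e (Suc (f i))) < (1/2) ^ i"
      "\<And>i. \<epsilon> (?s i) \<le> nrm (?s i) (e (f i))" "strict_mono f"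
    unfolding strict_mono_Suc_iff by blast
  have "nrm r (e (Suc (f i))) \<le> 1 * (1/2) ^ i" for i
    using f(1)[of i] by simp
  then obtain x where "limitin (step.mtopology r) (\<lambda>k. \<Sum>i<k. e (Suc (f i))) x sequentially"
    using step.geometric_series_limitin[of "\<lambda>i. e (Suc (f i))", OF step.e_in, where m = r and C = 1]
    by blast
  then have lim: "limitin T (\<lambda>k. \<Sum>i<k. e (Suc (f i))) x sequentially"
    using limitin_limit[of r] by (simp add: X_eq)
  have cf_x: "cf x (Suc (f i)) = 1" for i
  proof -
    have "cf (\<Sum>l<k. e (Suc (f l))) (Suc (f i)) = 1" if "k \<ge> Suc i" for k
      using that by (simp add: cf_sum cf_e strict_mono_eq[OF f(3)])
    then have "\<forall>\<^sub>F k in sequentially. cf (\<Sum>l<k. e (Suc (f l))) (Suc (f i)) = 1"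
      unfolding eventually_sequentially by blast
    then have "(\<lambda>k. cf (\<Sum>l<k. e (Suc (f l))) (Suc (f i))) \<longlonglongrightarrow> 1"
      by (rule tendsto_eventually)
    with cf_tendsto[OF lim] show ?thesis by (rule LIMSEQ_unique)
  qed
  obtain s where s: "B x \<in> E s" by (rule E_covers)
  have "(\<lambda>n. nrm s (scale (cf (B x) n) (e n))) \<longlonglongrightarrow> 0"
    using step.terms_converge_to_0[OF s] by (simp add: coef_eq_cf[OF s])
  from order_tendstoD(2)[OF this \<epsilon>(1)[of s]]
  obtain N where N: "\<And>n. n \<ge> N \<Longrightarrow> nrm s (scale (cf (B x) n) (e n)) < \<epsilon> s"
    unfolding eventually_sequentially by blast
  define i where "i = prod_encode (s, N)"
  have "N \<le> f i"
    using le_prod_encode_2[of N s] strict_mono_imp_increasing[OF f(3), of i] by (simp add: i_def)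
  then have "nrm s (e (f i)) < \<epsilon> s"
    using N[of "f i"] by (simp add: cf_B cf_x)
  then show False using f(2)[of i] by (simp add: i_def)
qed

lemma shift_steps_continuous:
  "\<exists>s. \<forall>\<epsilon>>0. \<exists>\<delta>>0. \<forall>i\<le>D. \<forall>j. nrm r (e (j + i)) < \<delta> \<longrightarrow> nrm s (e j) < \<epsilon>"
proof (induction D)
  case 0
  show ?case by (rule exI[of _ r]) auto
next
  case (Suc D)
  then obtain s where s: "\<And>\<epsilon>. 0 < \<epsilon> \<Longrightarrow> \<exists>\<delta>>0. \<forall>i\<le>D. \<forall>j. nrm r (e (j + i)) < \<delta> \<longrightarrow> nrm s (e j) < \<epsilon>"
    by blast
  obtain s' where s': "\<And>\<epsilon>. 0 < \<epsilon> \<Longrightarrow> \<exists>\<delta>>0. \<forall>j. nrm s (e (Suc j)) < \<delta> \<longrightarrow> nrm s' (e j) < \<epsilon>"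
    using shift_step_continuous[of s] by blast
  let ?t = "max s s'"
  have "\<exists>\<delta>>0. \<forall>i\<le>Suc D. \<forall>j. nrm r (e (j + i)) < \<delta> \<longrightarrow> nrm ?t (e j) < \<epsilon>" if \<epsilon>: "0 < \<epsilon>" for \<epsilon>
  proof -
    obtain \<delta>1 where \<delta>1: "0 < \<delta>1" "\<And>x. x \<in> E s \<Longrightarrow> nrm s x < \<delta>1 \<Longrightarrow> nrm ?t x < \<epsilon>"
      using nrm_mono[OF max.cobounded1 \<epsilon>, of s s'] by blast
    obtain \<delta>2 where \<delta>2: "0 < \<delta>2" "\<And>x. x \<in> E s' \<Longrightarrow> nrm s' x < \<delta>2 \<Longrightarrow> nrm ?t x < \<epsilon>"
      using nrm_mono[OF max.cobounded2 \<epsilon>, of s' s] by blast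
    obtain \<delta>3 where \<delta>3: "0 < \<delta>3" "\<And>j. nrm s (e (Suc j)) < \<delta>3 \<Longrightarrow> nrm s' (e j) < \<delta>2"
      using s'[OF \<delta>2(1)] by blast
    have "0 < min \<delta>1 \<delta>3" using \<delta>1 \<delta>3 by simp
    from s[OF this] obtain \<delta> where \<delta>: "0 < \<delta>"
      "\<And>i j. i \<le> D \<Longrightarrow> nrm r (e (j + i)) < \<delta> \<Longrightarrow> nrm s (e j) < min \<delta>1 \<delta>3"
      by blast
    have "nrm ?t (e j) < \<epsilon>" if i: "i \<le> Suc D" and small: "nrm r (e (j + i)) < \<delta>" for i j
    proof (cases "i \<le> D")
      case True
      then show ?thesis using \<delta>(2)[OF True small] \<delta>1(2)[OF step.e_in] by simp
    next
      case False
      then have "nrm r (e (Suc j + D)) < \<delta>" using i small by (simp add: le_Suc_eq)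
      from \<delta>(2)[OF order_refl this] show ?thesis
        using \<delta>3(2)[of j] \<delta>2(2)[OF step.e_in] by simp
    qed
    then show ?thesis using \<delta>(1) by blast
  qed
  then show ?case by blast
qed

section \<open>Long windows of small basis vectors in one step\<close>

lemma long_small_windows:
  assumes mixing: "mixing T B"
  shows "\<exists>m. \<forall>\<epsilon>>0. \<forall>L N. \<exists>n\<ge>N. \<forall>i\<le>L. nrm m (e (n + i)) < \<epsilon>"
proof (rule ccontr)
  assume "\<not> ?thesis"
  then have "\<exists>\<epsilon> L N. 0 < \<epsilon> \<and> (\<forall>n\<ge>N. \<exists>i\<le>L. \<epsilon> \<le> nrm m (e (n + i)))" for m
    by (meson not_le)
  then obtain \<epsilon> L N where \<epsilon>: "\<And>m. 0 < \<epsilon> m"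
      and peak: "\<And>m n. N m \<le> n \<Longrightarrow> \<exists>i\<le>L m. \<epsilon> m \<le> nrm m (e (n + i))"
    by metis
  define \<sigma> where "\<sigma> r D = (SOME s. \<forall>\<epsilon>>0. \<exists>\<delta>>0. \<forall>i\<le>D. \<forall>j.
      nrm r (e (j + i)) < \<delta> \<longrightarrow> nrm s (e j) < \<epsilon>)" for r D
  have \<sigma>: "\<exists>\<delta>>0. \<forall>i\<le>D. \<forall>j. nrm r (e (j + i)) < \<delta> \<longrightarrow> nrm (\<sigma> r D) (e j) < \<epsilon>"
    if "0 < \<epsilon>" for r D \<epsilon>
    using someI_ex[OF shift_steps_continuous[of D r]] that unfolding \<sigma>_def[symmetric] by blast
  \<comment> \<open>The level \<open>M r\<close> is chosen so large that a peak of level \<open>M r\<close> bounds \<open>nrm r\<close> from below at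
    all indices up to \<open>D r\<close> places to the right. Here \<open>D r\<close> is the sum of the gaps of the levels
    \<open>M r'\<close> with \<open>r' < r\<close>, that is, the length of the walk from a peak of level \<open>M r\<close> through
    peaks of the levels \<open>M (r - 1), \<dots>, M 0\<close>.\<close>
  define D where "D = rec_nat 0 (\<lambda>r d. d + L (\<sigma> r d))"
  define M where "M r = \<sigma> r (D r)" for r
  have D_Suc: "D (Suc r) = D r + L (M r)" for r by (simp add: D_def M_def)
  have "\<exists>\<delta>>0. \<forall>i\<le>D r. \<forall>j. nrm r (e (j + i)) < \<delta> \<longrightarrow> nrm (M r) (e j) < \<epsilon> (M r)" for r
    unfolding M_def by (rule \<sigma>[OF \<epsilon>])
  then obtain \<delta> where \<delta>: "\<And>r. 0 < \<delta> r"
      "\<And>r i j. i \<le> D r \<Longrightarrow> nrm r (e (j + i)) < \<delta> r \<Longrightarrow> nrm (M r) (e j) < \<epsilon> (M r)"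
    by metis
  have walk: "\<exists>j. n \<le> j \<and> j \<le> n + D k \<and>
      (\<forall>r<k. \<exists>i\<le>D r. i \<le> j \<and> \<epsilon> (M r) \<le> nrm (M r) (e (j - i)))"
    if "\<And>r. r < k \<Longrightarrow> N (M r) \<le> n" for n k
    using that
  proof (induction k arbitrary: n)
    case 0
    show ?case by (intro exI[of _ n]) (simp add: D_def)
  next
    case (Suc k)
    obtain i0 where i0: "i0 \<le> L (M k)" "\<epsilon> (M k) \<le> nrm (M k) (e (n + i0))"
      using peak[of "M k" n] Suc.prems by auto
    have "\<And>r. r < k \<Longrightarrow> N (M r) \<le> n + i0"
      using Suc.prems by (simp add: trans_le_add1)
    from Suc.IH[OF this] obtain j where j: "n + i0 \<le> j" "j \<le> n + i0 + D k"
      "\<And>r. r < k \<Longrightarrow> \<exists>i\<le>D r. i \<le> j \<and> \<epsilon> (M r) \<le> nrm (M r) (e (j - i))" by blast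
    have "\<exists>i\<le>D r. i \<le> j \<and> \<epsilon> (M r) \<le> nrm (M r) (e (j - i))" if "r < Suc k" for r
    proof (cases "r = k")
      case True
      show ?thesis unfolding True
        using j(1,2) i0(2) by (intro exI[of _ "j - (n + i0)"]) auto
    next
      case False
      then show ?thesis using that j(3) by simp
    qed
    then show ?case using j(1,2) i0(1) by (intro exI[of _ j]) (auto simp: D_Suc)
  qed
  have "\<exists>j\<ge>K. \<forall>r<K. \<delta> r \<le> nrm r (e j)" for K
  proof -
    let ?n = "K + (\<Sum>r<K. N (M r))"
    have "N (M r) \<le> ?n" if "r < K" for r
      using member_le_sum[of r "{..<K}" "\<lambda>r. N (M r)"] that by simp
    from walk[OF this] obtain j where j: "?n \<le> j"
      "\<And>r. r < K \<Longrightarrow> \<exists>i\<le>D r. i \<le> j \<and> \<epsilon> (M r) \<le> nrm (M r) (e (j - i))" by blast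
    have "\<delta> r \<le> nrm r (e j)" if r: "r < K" for r
    proof (rule ccontr)
      assume "\<not> \<delta> r \<le> nrm r (e j)"
      moreover obtain i where "i \<le> D r" "i \<le> j" "\<epsilon> (M r) \<le> nrm (M r) (e (j - i))"
        using j(2)[OF r] by blast
      ultimately show False using \<delta>(2)[of i r "j - i"] by simp
    qed
    then show ?thesis using j(1) by (intro exI[of _ j]) simp
  qed
  then obtain J where J: "\<And>K. K \<le> J K" "\<And>K r. r < K \<Longrightarrow> \<delta> r \<le> nrm r (e (J K))"
    by metis
  \<comment> \<open>For each \<open>r\<close>, only the finitely many \<open>J K\<close> with \<open>K \<le> r\<close> are not controlled by \<open>\<delta> r\<close>.\<close>
  define \<eta> where "\<eta> r = Min (insert (\<delta> r) ((\<lambda>K. nrm r (e (J K))) ` {..r}))" for r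
  have "0 < \<eta> r" for r using \<delta>(1) nrm_e_pos by (simp add: \<eta>_def)
  then have fin: "finite {n. \<forall>m. \<eta> m \<le> nrm m (e n)}" by (rule mixing_imp_finite_large[OF mixing])
  have "\<eta> m \<le> nrm m (e (J K))" for m K
  proof (cases "m < K")
    case True
    have "\<eta> m \<le> \<delta> m" by (simp add: \<eta>_def)
    then show ?thesis using J(2)[OF True] by simp
  next
    case False
    then show ?thesis unfolding \<eta>_def by (intro Min_le) auto
  qed
  then have "range J \<subseteq> {n. \<forall>m. \<eta> m \<le> nrm m (e n)}" by blast
  then obtain C where "\<And>K. J K \<le> C"
    using fin finite_nat_set_iff_bounded_le by (meson in_mono rangeI)
  then show False using J(1)[of "Suc C"] by (meson Suc_n_not_le_n order_trans)
qed

section \<open>A vector with sequentially dense orbit\<close>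

text \<open>The finite combination of basis vectors with coefficient list \<open>c\<close>, shifted to start at index \<open>t\<close>.\<close>

definition combo :: "'k list \<Rightarrow> nat \<Rightarrow> 'a" where
  "combo c t = (\<Sum>i<length c. scale (c ! i) (e (t + i)))"

lemma combo_in [simp]: "combo c t \<in> E m"
  unfolding combo_def by (rule step.V_sum) simp

lemma B_pow_0: "(B ^^ n) 0 = 0"
  by (induction n) (simp_all add: B_0)

lemma B_pow_add: "(B ^^ n) (x + y) = (B ^^ n) x + (B ^^ n) y"
  by (induction n) (simp_all add: B_add)

lemma B_pow_sum: "(B ^^ n) (sum f I) = (\<Sum>i\<in>I. (B ^^ n) (f i))"
  by (induction n) (simp_all add: B_sum)

lemma B_pow_scale: "(B ^^ n) (scale c x) = scale c ((B ^^ n) x)"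
  by (induction n) (simp_all add: B_scale)

lemma B_pow_e: "(B ^^ n) (e (n + j)) = e j"
  by (induction n) (simp_all add: B_e_Suc funpow_swap1)

lemma B_pow_e_less: "j < n \<Longrightarrow> (B ^^ n) (e j) = 0"
proof (induction n arbitrary: j)
  case (Suc n)
  show ?case
  proof (cases j)
    case 0
    then show ?thesis by (simp add: funpow_swap1 B_e_0 B_pow_0)
  next
    case (Suc i)
    then show ?thesis using Suc.IH[of i] Suc.prems by (simp add: funpow_swap1 B_e_Suc)
  qed
qed simp

lemma B_pow_combo: "(B ^^ n) (combo c (n + t)) = combo c t"
  by (simp add: combo_def B_pow_sum B_pow_scale B_pow_e add.assoc)

lemma B_pow_combo_eq_0: "t + length c \<le> n \<Longrightarrow> (B ^^ n) (combo c t) = 0"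
  by (auto simp: combo_def B_pow_sum B_pow_scale B_pow_e_less intro!: sum.neutral)

lemma limitin_B_pow: "limitin T f l F \<Longrightarrow> limitin T (\<lambda>k. (B ^^ n) (f k)) ((B ^^ n) l) F"
  by (induction n) (simp_all add: limitin_B)

lemma combo_approximates_combination:
  assumes C: "\<And>S. open S \<Longrightarrow> S \<noteq> {} \<Longrightarrow> \<exists>d\<in>C. d \<in> S" and "0 < \<eta>"
  shows "\<exists>c\<in>lists C. length c = n \<and> nrm s (combo c 0 - (\<Sum>j<n. scale (a j) (e j))) < \<eta>"
  using assms(2)
proof (induction n arbitrary: \<eta>)
  case 0
  then show ?case by (intro bexI[of _ "[]"]) (simp_all add: combo_def)
next
  case (Suc n)
  then have half: "0 < \<eta> / 2" by simp
  obtain c where c: "c \<in> lists C" "length c = n"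
    "nrm s (combo c 0 - (\<Sum>j<n. scale (a j) (e j))) < \<eta> / 2"
    using Suc.IH[OF half] by blast
  obtain \<rho> where \<rho>: "0 < \<rho>" "\<And>c. norm c < \<rho> \<Longrightarrow> nrm s (scale c (e n)) < \<eta> / 2"
    using step.scale_vector_small[OF step.e_in half, where m = s] by blast
  obtain d where d: "d \<in> C" "d \<in> ball (a n) \<rho>"
    using C[of "ball (a n) \<rho>"] \<rho>(1) by auto
  have "combo (c @ [d]) 0 = combo c 0 + scale d (e n)"
    by (simp add: combo_def c(2) nth_append)
  then have "combo (c @ [d]) 0 - (\<Sum>j<Suc n. scale (a j) (e j))
      = (combo c 0 - (\<Sum>j<n. scale (a j) (e j))) + scale (d - a n) (e n)"
    by (simp add: scale_left_diff_distrib algebra_simps)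
  then have "nrm s (combo (c @ [d]) 0 - (\<Sum>j<Suc n. scale (a j) (e j)))
      \<le> nrm s (combo c 0 - (\<Sum>j<n. scale (a j) (e j))) + nrm s (scale (d - a n) (e n))"
    using step.nr_add[of "combo c 0 - (\<Sum>j<n. scale (a j) (e j))" s "scale (d - a n) (e n)"]
    by (simp only:) simp
  also have "\<dots> < \<eta>"
    using c(3) \<rho>(2)[of "d - a n"] d(2) by (simp add: dist_norm norm_minus_commute)
  finally show ?case
    using c d(1) by (intro bexI[of _ "c @ [d]"]) auto
qed

lemma combo_dense:
  assumes C: "\<And>S. open S \<Longrightarrow> S \<noteq> {} \<Longrightarrow> \<exists>d\<in>C. d \<in> S" and y: "y \<in> E s" and \<eta>: "0 < \<eta>"
  obtains c where "c \<in> lists C" "nrm s (combo c 0 - y) < \<eta>"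
proof -
  have half: "0 < \<eta> / 2" using \<eta> by simp
  obtain n where n: "nrm s (step.S s n y - y) < \<eta> / 2"
    using order_tendstoD(2)[OF step.S_converges[OF y] half] unfolding eventually_sequentially by blast
  obtain c where c: "c \<in> lists C" "nrm s (combo c 0 - step.S s n y) < \<eta> / 2"
    using combo_approximates_combination[OF C half, of n s "cf y"] unfolding S_eq[OF y] by blast
  have "nrm s (combo c 0 - y) \<le> nrm s (combo c 0 - step.S s n y) + nrm s (step.S s n y - y)"
    using step.nr_add[of "combo c 0 - step.S s n y" s "step.S s n y - y"] y by simp
  then show thesis using c n by (intro that[of c]) auto
qed

text \<open>
  The vector \<open>x\<close> is the sum of the combinations \<open>c k\<close> placed at the indices \<open>n k\<close>. The blocks do
  not overlap, so \<open>B\<^bsup>n l\<^esup>\<close> kills the blocks before the one of \<open>c l\<close> and moves this one to index \<open>0\<close>.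
  The blocks of \<open>c k\<close> with \<open>k > l\<close> stay small because each of them lies in a window of small basis
  vectors that starts at least \<open>n l\<close> places before \<open>n k\<close>.
\<close>

lemma sequentially_hypercyclic_if_small_windows:
  assumes windows: "\<And>\<epsilon> L N. 0 < \<epsilon> \<Longrightarrow> \<exists>n\<ge>N. \<forall>i\<le>L. nrm m (e (n + i)) < \<epsilon>"
  shows "sequentially_hypercyclic T B"
proof -
  obtain C :: "'k set" where C: "countable C" "\<And>S. open S \<Longrightarrow> S \<noteq> {} \<Longrightarrow> \<exists>d\<in>C. d \<in> S"
    by (rule countable_dense_setE) blast
  \<comment> \<open>An enumeration of the coefficient lists that repeats each of them infinitely often.\<close>
  define c where "c k = from_nat_into (lists C) (fst (prod_decode k))" for k
  have c_often: "\<exists>k\<ge>N. c k = l" if l: "l \<in> lists C" for l N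
  proof -
    from from_nat_into_surj[OF countable_lists[OF C(1)] l]
    obtain i where "from_nat_into (lists C) i = l" by (elim exE)
    then have "c (prod_encode (i, N)) = l" by (simp add: c_def)
    then show ?thesis
      using le_prod_encode_2[of N i] by (intro exI[of _ "prod_encode (i, N)"]) simp
  qed
  have place: "\<exists>n'\<ge>N. \<forall>t\<le>a. nrm m (combo b (n' - t)) < \<epsilon>" if \<epsilon>: "0 < \<epsilon>" for N a b \<epsilon>
  proof -
    obtain \<delta> where \<delta>: "0 < \<delta>" "\<And>z. (\<forall>i<length b. z i \<in> E m \<and> nrm m (z i) < \<delta>) \<Longrightarrow>
        nrm m (\<Sum>i<length b. scale (b ! i) (z i)) < \<epsilon>"
      using step.combination_small[OF \<epsilon>, of "length b" m "\<lambda>i. b ! i"] by blast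
    obtain n where n: "N \<le> n" "\<And>i. i \<le> a + length b \<Longrightarrow> nrm m (e (n + i)) < \<delta>"
      using windows[OF \<delta>(1)] by blast
    have "nrm m (combo b (n + a - t)) < \<epsilon>" if "t \<le> a" for t
      unfolding combo_def
    proof (rule \<delta>(2), intro allI impI conjI)
      fix i assume i: "i < length b"
      have "n + a - t + i = n + (a - t + i)" using \<open>t \<le> a\<close> by simp
      then show "nrm m (e (n + a - t + i)) < \<delta>"
        using n(2)[of "a - t + i"] i by (simp add: add.assoc)
    qed simp
    then show ?thesis using n(1) by (intro exI[of _ "n + a"]) auto
  qed
  have "\<exists>n. \<forall>k. nrm m (combo (c k) (n k)) < (1/2) ^ k \<and>
      (n k + length (c k) \<le> n (Suc k) \<and>
       (\<forall>t\<le>n k. nrm m (combo (c (Suc k)) (n (Suc k) - t)) < (1/2) ^ Suc k))"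
  proof (rule dependent_nat_choice)
    show "\<exists>n. nrm m (combo (c 0) n) < (1/2) ^ 0"
      using place[of "(1/2) ^ 0" 0 0 "c 0"] by auto
    fix n k
    show "\<exists>n'. nrm m (combo (c (Suc k)) n') < (1/2) ^ Suc k \<and>
        (n + length (c k) \<le> n' \<and> (\<forall>t\<le>n. nrm m (combo (c (Suc k)) (n' - t)) < (1/2) ^ Suc k))"
      using place[of "(1/2) ^ Suc k" "n + length (c k)" n "c (Suc k)"] by fastforce
  qed
  then obtain n where n_small: "\<And>k. nrm m (combo (c k) (n k)) < (1/2) ^ k"
      and n_Suc: "\<And>k. n k + length (c k) \<le> n (Suc k)"
      and n_back: "\<And>k t. t \<le> n k \<Longrightarrow> nrm m (combo (c (Suc k)) (n (Suc k) - t)) < (1/2) ^ Suc k"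
    by blast
  have n_mono: "n k \<le> n l" if "k \<le> l" for k l
    using that by (rule lift_Suc_mono_le[rotated]) (meson n_Suc add_leD1)
  have n_gap: "n k + length (c k) \<le> n l" if "k < l" for k l
    using n_Suc[of k] n_mono[of "Suc k" l] that by simp
  have "nrm m (combo (c k) (n k)) \<le> 1 * (1/2) ^ k" for k
    using n_small[of k] by simp
  then obtain x where x: "limitin (step.mtopology m) (\<lambda>N. \<Sum>k<N. combo (c k) (n k)) x sequentially"
    using step.geometric_series_limitin[of "\<lambda>k. combo (c k) (n k)" m 1, OF combo_in] by blast
  then have x_T: "limitin T (\<lambda>N. \<Sum>k<N. combo (c k) (n k)) x sequentially"
    using limitin_limit[of m] by (simp add: X_eq)
  have orbit: "\<exists>r\<in>E m. (B ^^ n l) x = combo (c l) 0 + r \<and> nrm m r \<le> (1/2) ^ l" for l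
  proof -
    let ?g = "\<lambda>i. combo (c (Suc l + i)) (n (Suc l + i) - n l)"
    have small: "nrm m (?g i) \<le> (1/2) ^ Suc l * (1/2) ^ i" for i
      using n_back[OF n_mono, of l "l + i"] by (simp add: power_add)
    obtain r where r: "limitin (step.mtopology m) (\<lambda>N. \<Sum>i<N. ?g i) r sequentially"
        "nrm m r \<le> 2 * (1/2) ^ Suc l"
      using step.geometric_series_limitin[of ?g m "(1/2) ^ Suc l", OF combo_in small] by blast
    have rE: "r \<in> E m" using step.limitin_mspace[OF r(1)] .
    have "limitin (step.mtopology m) (\<lambda>N. combo (c l) 0 + (\<Sum>i<N. ?g i)) (combo (c l) 0 + r) sequentially"
      using r(1) by (intro step.limitin_add) (auto intro: step.V_sum)
    then have 1: "limitin T (\<lambda>N. combo (c l) 0 + (\<Sum>i<N. ?g i)) (combo (c l) 0 + r) sequentially"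
      using limitin_limit[of m] by (simp add: X_eq)
    have "(B ^^ n l) (\<Sum>k<Suc l + N. combo (c k) (n k)) = combo (c l) 0 + (\<Sum>i<N. ?g i)" for N
    proof (induction N)
      case 0
      have "(B ^^ n l) (\<Sum>k<l. combo (c k) (n k)) = 0"
        unfolding B_pow_sum by (intro sum.neutral ballI B_pow_combo_eq_0 n_gap) simp
      then show ?case using B_pow_combo[of "n l" "c l" 0] by (simp add: B_pow_add)
    next
      case (Suc N)
      have "n l + (n (Suc l + N) - n l) = n (Suc l + N)"
        using n_mono[of l "Suc l + N"] by simp
      then have "(B ^^ n l) (combo (c (Suc l + N)) (n (Suc l + N))) = ?g N"
        using B_pow_combo[of "n l" "c (Suc l + N)" "n (Suc l + N) - n l"] by simp
      then show ?case
        using Suc.IH by (simp add: B_pow_add add.assoc)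
    qed
    moreover have "limitin T ((\<lambda>N. \<Sum>k<N. combo (c k) (n k)) \<circ> (+) (Suc l)) x sequentially"
      using x_T by (intro limitin_subsequence) (simp_all add: strict_mono_def)
    from limitin_B_pow[OF this, of "n l"]
    have "limitin T (\<lambda>N. (B ^^ n l) (\<Sum>k<Suc l + N. combo (c k) (n k))) ((B ^^ n l) x) sequentially"
      by (simp only: o_def)
    ultimately have 2: "limitin T (\<lambda>N. combo (c l) 0 + (\<Sum>i<N. ?g i)) ((B ^^ n l) x) sequentially"
      by simp
    have "(B ^^ n l) x = combo (c l) 0 + r"
      using limitin_Hausdorff_unique[OF 2 1] hausdorff by simp
    then show ?thesis using rE r(2) by auto
  qed
  then obtain r where rE: "\<And>l. r l \<in> E m" and r_eq: "\<And>l. (B ^^ n l) x = combo (c l) 0 + r l"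
      and r_small: "\<And>l. nrm m (r l) \<le> (1/2) ^ l"
    by metis
  have "\<exists>s. range s \<subseteq> range (\<lambda>n. (B ^^ n) x) \<and> limitin T s y sequentially" for y
  proof -
    obtain p where y: "y \<in> E p" by (rule E_covers)
    have "\<exists>k\<ge>q. nrm p (combo (c k) 0 - y) < (1/2) ^ q" for q
    proof -
      have "0 < (1/2::real) ^ q" by simp
      then obtain b where "b \<in> lists C" "nrm p (combo b 0 - y) < (1/2) ^ q"
        using combo_dense[OF C(2) y] by blast
      then show ?thesis using c_often[of b q] by auto
    qed
    then obtain k where k: "\<And>q. q \<le> k q" "\<And>q. nrm p (combo (c (k q)) 0 - y) < (1/2) ^ q"
      by metis
    have pow: "(\<lambda>q. (1/2::real) ^ q) \<longlonglongrightarrow> 0"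
      by (rule LIMSEQ_power_zero) simp
    let ?M = "max m p"
    have X_M: "X ?M = step.mtopology ?M" by (rule X_eq)
    have "(\<lambda>q. nrm p (combo (c (k q)) 0 - y)) \<longlonglongrightarrow> 0"
      using k(2) by (intro step.nr_squeeze[OF _ pow] less_imp_le)
    then have "limitin (X p) (\<lambda>q. combo (c (k q)) 0) y sequentially"
      using y by (simp add: X_eq step.limitin_iff_nr)
    then have 1: "limitin (X ?M) (\<lambda>q. combo (c (k q)) 0) y sequentially"
      by (rule limitin_step[rotated]) simp
    have "nrm m (r (k q)) \<le> (1/2) ^ q" for q
      by (rule order_trans[OF r_small power_decreasing[OF k(1)]]) simp_all
    then have "(\<lambda>q. nrm m (r (k q))) \<longlonglongrightarrow> 0"
      by (rule step.nr_squeeze[OF _ pow])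
    then have "limitin (X m) (\<lambda>q. r (k q)) 0 sequentially"
      using rE by (simp add: X_eq step.limitin_iff_nr)
    then have 2: "limitin (X ?M) (\<lambda>q. r (k q)) 0 sequentially"
      by (rule limitin_step[rotated]) simp
    have rM: "r l \<in> E ?M" for l using rE[of l] E_mono[of m ?M] by auto
    have "limitin (X ?M) (\<lambda>q. combo (c (k q)) 0 + r (k q)) (y + 0) sequentially"
      using step.limitin_add[OF 1[unfolded X_M] 2[unfolded X_M] combo_in rM] unfolding X_M .
    then have "limitin T (\<lambda>q. (B ^^ n (k q)) x) y sequentially"
      using limitin_limit[of ?M] by (simp add: r_eq)
    then show ?thesis by (intro exI[of _ "\<lambda>q. (B ^^ n (k q)) x"]) auto
  qed
  then show ?thesis
    unfolding sequentially_hypercyclic_def by (auto simp: topspace_T)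
qed

end

theorem proposition2p8:
  fixes scale :: "'k::{real_normed_field,euclidean_space} \<Rightarrow> 'a::ab_group_add \<Rightarrow> 'a"
    and E :: "nat \<Rightarrow> 'a set" and X :: "nat \<Rightarrow> 'a topology" and T :: "'a topology"
    and e :: "nat \<Rightarrow> 'a" and B :: "'a \<Rightarrow> 'a"
  assumes "lf_space scale E X T"
    and "lf_space.stepwise_schauder_basis scale E X e"
    and "lf_space.associated_backward_shift scale T e B"
    and "mixing T B"
  shows "sequentially_hypercyclic T B"
proof -
  interpret lf_shift scale E X T e B
    using assms(1-3) by (intro lf_shift.intro lf_shift_axioms.intro)
  obtain m where "\<forall>\<epsilon>>0. \<forall>L N. \<exists>n\<ge>N. \<forall>i\<le>L. nrm m (e (n + i)) < \<epsilon>"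
    using long_small_windows[OF assms(4)] by blast
  then show ?thesis
    by (intro sequentially_hypercyclic_if_small_windows[of m]) blast
qed

end
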